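(* Let $T>0$, let $k\ge 1$ be an integer, let $\mathbf y_0,\dot{\mathbf y}_0\in\mathbb R^2$ be fixed (independent of $\varepsilon$), and let $\mathbf E:\mathbb R^2\to\mathbb R^2$ have Lipschitz-continuous derivatives up to order $k$ (i.e. $\mathbf E$ is $C^k$ and all its partial derivatives of orders $0,1,\dots,k$ are globally Lipschitz on $\mathbb R^2$). Then there exist constants $\varepsilon_0>0$ and $C>0$, independent of $\varepsilon$ and of the time step, such that for every $0<\varepsilon\le\varepsilon_0$ and every integer $N\ge1$, with $\Delta t=T/N$ and $t_n=n\Delta t$, the following holds. Let $\mathbf y:[0,T]\to\mathbb R^2$ be the solution of $$\ddot{\mathbf y}=\tfrac1\varepsilon J\dot{\mathbf y}+\mathbf E(\mathbf y),\qquad \mathbf y(0)=\mathbf y_0,\quad \dot{\mathbf y}(0)=\dot{\mathbf y}_0,\qquad J=\begin{bmatrix}0&1\\-1&0\end{bmatrix},$$ and let $(\mathbf Y_n,\dot{\mathbf Y}_n)_{n=0}^N$ be the numerical solutions produced by the order-$k$ local linear extension exponential integrator (defined in the context) with step size $h=\Delta t$ (the case $\nu=0$). Then $$\|\mathbf y(t_n)-\mathbf Y_n\|+\varepsilon\|\dot{\mathbf y}(t_n)-\dot{\mathbf Y}_n\|\le\min\{C\varepsilon^{k+2},\,C\varepsilon\,\Delta t^{k+1}\},\qquad n=0,1,\dots,N.$$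
   Context: $\|\cdot\|$ is the Euclidean norm. Multi-indices. Let $\mathbb I^{[k]}$ be the set of $\alpha=(\alpha_1,\alpha_2,\alpha_3,\alpha_4)$ with nonnegative integer entries and length $|\alpha|=\alpha_1+\alpha_2+\alpha_3+\alpha_4\le k$, and let $D^{[k]}$ be its cardinality. Let $e_1,\dots,e_4$ be the standard unit vectors of $\mathbb R^4$, regarded also as multi-indices. Vectors $v\in\mathbb R^{D^{[k]}}$ are indexed by multi-indices, $v=(v_\alpha)_{\alpha\in\mathbb I^{[k]}}$ (in any fixed ordering in which the zero multi-index comes first, then $e_1,e_2,e_3,e_4$, then the rest by increasing length). Let $e_1^{D^{[k]}}$ be the vector with entry $1$ at $\alpha=0$ and $0$ elsewhere, and let $\Pi_{\mathbf x}:\mathbb R^{D^{[k]}}\to\mathbb R^4$, $\Pi_{\mathbf x}v=(v_{e_1},v_{e_2},v_{e_3},v_{e_4})^\top$. Matrices. For $\hat{\mathbf x}=(\hat x_1,\hat x_2,\hat x_3,\hat x_4)^\top\in\mathbb R^4$ with $\hat{\mathbf y}=(\hat x_1,\hat x_2)^\top$, the $D^{[k]}\times D^{[k]}$ matrices $A_1^{[k]}(\hat{\mathbf x})$ and $A_0^{[k]}(\hat{\mathbf x})$ are defined by (terms whose coefficient $\alpha_j$ is zero are omitted) $$\begin{aligned}(A_1^{[k]}(\hat{\mathbf x})v)_\alpha={}&\alpha_1v_{\alpha-e_1+e_3}+\alpha_2v_{\alpha-e_2+e_4}+\alpha_1\hat x_3v_{\alpha-e_1}+\alpha_2\hat x_4v_{\alpha-e_2}\\&+\alpha_3v_{\alpha-e_3+e_4}-\alpha_4v_{\alpha-e_4+e_3}+\alpha_3\hat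 x_4v_{\alpha-e_3}-\alpha_4\hat x_3v_{\alpha-e_4},\end{aligned}$$ $$(A_0^{[k]}(\hat{\mathbf x})v)_\alpha=\sum_{\substack{\beta=(\beta_1,\beta_2,0,0)\\|\beta|\le k-|\alpha|+1}}\frac{1}{\beta_1!\beta_2!}\left(\alpha_3\,\partial^\beta E_1(\hat{\mathbf y})\,v_{\alpha+\beta-e_3}+\alpha_4\,\partial^\beta E_2(\hat{\mathbf y})\,v_{\alpha+\beta-e_4}\right),$$ where $\partial^\beta=\partial_{y_1}^{\beta_1}\partial_{y_2}^{\beta_2}$ and $\mathbf E=(E_1,E_2)^\top$. Scheme. For the problem on $[0,T/\varepsilon^\nu]$, $\nu\in\{0,1\}$, with $\Delta t=T/N$ and actual time step $h=\Delta t/\varepsilon^\nu$: set $\mathbf X_0=[\mathbf y_0^\top,\varepsilon\dot{\mathbf y}_0^\top]^\top\in\mathbb R^4$ and for $n=0,\dots,N-1$ $$\mathbf X_{n+1}=\mathbf X_n+\Pi_{\mathbf x}\exp\!\left(\left(\varepsilon^{-1-\nu}A_1^{[k]}(\mathbf X_n)+\varepsilon^{1-\nu}A_0^{[k]}(\mathbf X_n)\right)\Delta t\right)e_1^{D^{[k]}}.$$ The numerical position $\mathbf Y_n\in\mathbb R^2$ consists of the first two components of $\mathbf X_n$, and the numerical velocity $\dot{\mathbf Y}_n\in\mathbb R^2$ is $\varepsilon^{-1}$ times the last two components of $\mathbf X_n$. This is the order-$k$ local linear extension exponential integrator. The constants $\varepsilon_0,C$ may depend on $T$, $k$, $\mathbf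 E$, $\mathbf y_0$, $\dot{\mathbf y}_0$. *)

theory Defs
  imports "HOL-Analysis.Analysis"
begin

text \<open>The size of the matrices below depends on a natural number \<open>k\<close>, so they cannot be
  elements of a type \<open>real ^ 'n ^ 'n\<close>. A square matrix with rows and columns indexed by a finite
  set \<open>S\<close> is a function of two indices, of which only the values on \<open>S \<times> S\<close> matter.\<close>

definition unit_vec :: "'i \<Rightarrow> 'i \<Rightarrow> real" where
  "unit_vec j = (\<lambda>i. if i = j then 1 else 0)"

definition mat_of :: "'i set \<Rightarrow> (('i \<Rightarrow> real) \<Rightarrow> 'i \<Rightarrow> real) \<Rightarrow> 'i \<Rightarrow> 'i \<Rightarrow> real" where
  "mat_of S L = (\<lambda>i j. if i \<in> S \<and> j \<in> S then L (unit_vec j) i else 0)"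

definition mat_app :: "'i set \<Rightarrow> ('i \<Rightarrow> 'i \<Rightarrow> real) \<Rightarrow> ('i \<Rightarrow> real) \<Rightarrow> 'i \<Rightarrow> real" where
  "mat_app S M v = (\<lambda>i. \<Sum>j\<in>S. M i j * v j)"

primrec mat_pow :: "'i set \<Rightarrow> ('i \<Rightarrow> 'i \<Rightarrow> real) \<Rightarrow> nat \<Rightarrow> 'i \<Rightarrow> 'i \<Rightarrow> real" where
  "mat_pow S M 0 = (\<lambda>i j. if i = j then 1 else 0)"
| "mat_pow S M (Suc n) = (\<lambda>i j. \<Sum>l\<in>S. M i l * mat_pow S M n l j)"

definition mat_exp :: "'i set \<Rightarrow> ('i \<Rightarrow> 'i \<Rightarrow> real) \<Rightarrow> 'i \<Rightarrow> 'i \<Rightarrow> real" where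
  "mat_exp S M = (\<lambda>i j. \<Sum>n. mat_pow S M n i j / fact n)"


type_synonym mindex = "nat ^ 4"

definition mlen :: "mindex \<Rightarrow> nat" where
  "mlen \<alpha> = \<alpha> $ 1 + \<alpha> $ 2 + \<alpha> $ 3 + \<alpha> $ 4"

definition mindices :: "nat \<Rightarrow> mindex set" where
  "mindices k = {\<alpha>. mlen \<alpha> \<le> k}"

abbreviation munit :: "4 \<Rightarrow> mindex" where
  "munit i \<equiv> axis i 1"

definition partial :: "2 \<Rightarrow> (real ^ 2 \<Rightarrow> real) \<Rightarrow> real ^ 2 \<Rightarrow> real" where
  "partial j f = (\<lambda>y. deriv (\<lambda>t. f (y + t *\<^sub>R axis j 1)) 0)"

definition partials :: "nat \<Rightarrow> nat \<Rightarrow> (real ^ 2 \<Rightarrow> real) \<Rightarrow> real ^ 2 \<Rightarrow> real" where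
  "partials b\<^sub>1 b\<^sub>2 f = (partial 1 ^^ b\<^sub>1) ((partial 2 ^^ b\<^sub>2) f)"

primrec of_class_C :: "nat \<Rightarrow> (real ^ 2 \<Rightarrow> real) \<Rightarrow> bool" where
  "of_class_C 0 f \<longleftrightarrow> continuous_on UNIV f"
| "of_class_C (Suc k) f \<longleftrightarrow> (\<forall>y. f differentiable (at y)) \<and> (\<forall>j. of_class_C k (partial j f))"

definition lipschitz_derivatives :: "nat \<Rightarrow> (real ^ 2 \<Rightarrow> real ^ 2) \<Rightarrow> bool" where
  "lipschitz_derivatives k E \<longleftrightarrow>
     (\<forall>i. of_class_C k (\<lambda>y. E y $ i) \<and>
          (\<forall>b\<^sub>1 b\<^sub>2. b\<^sub>1 + b\<^sub>2 \<le> k \<longrightarrow> (\<exists>L. L-lipschitz_on UNIV (partials b\<^sub>1 b\<^sub>2 (\<lambda>y. E y $ i)))))"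


text \<open>In both actions the subtraction of multi-indices truncates at zero; this only affects terms
  whose coefficient \<open>\<alpha> $ j\<close> vanishes.\<close>

definition A1_action :: "real ^ 4 \<Rightarrow> (mindex \<Rightarrow> real) \<Rightarrow> mindex \<Rightarrow> real" where
  "A1_action x v \<alpha> =
     real (\<alpha> $ 1) * v (\<alpha> - munit 1 + munit 3) + real (\<alpha> $ 2) * v (\<alpha> - munit 2 + munit 4)
     + real (\<alpha> $ 1) * x $ 3 * v (\<alpha> - munit 1) + real (\<alpha> $ 2) * x $ 4 * v (\<alpha> - munit 2)
     + real (\<alpha> $ 3) * v (\<alpha> - munit 3 + munit 4) - real (\<alpha> $ 4) * v (\<alpha> - munit 4 + munit 3)
     + real (\<alpha> $ 3) * x $ 4 * v (\<alpha> - munit 3) - real (\<alpha> $ 4) * x $ 3 * v (\<alpha> - munit 4)"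

definition position_part :: "real ^ 4 \<Rightarrow> real ^ 2" where
  "position_part x = vector [x $ 1, x $ 2]"

definition A0_action ::
  "nat \<Rightarrow> (real ^ 2 \<Rightarrow> real ^ 2) \<Rightarrow> real ^ 4 \<Rightarrow> (mindex \<Rightarrow> real) \<Rightarrow> mindex \<Rightarrow> real" where
  "A0_action k E x v \<alpha> =
     (\<Sum>\<beta> | \<beta> $ 3 = 0 \<and> \<beta> $ 4 = 0 \<and> mlen \<beta> \<le> k - mlen \<alpha> + 1.
        1 / (fact (\<beta> $ 1) * fact (\<beta> $ 2)) *
        (real (\<alpha> $ 3) * partials (\<beta> $ 1) (\<beta> $ 2) (\<lambda>y. E y $ 1) (position_part x) * v (\<alpha> + \<beta> - munit 3)
         + real (\<alpha> $ 4) * partials (\<beta> $ 1) (\<beta> $ 2) (\<lambda>y. E y $ 2) (position_part x) * v (\<alpha> + \<beta> - munit 4)))"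

definition A1 :: "nat \<Rightarrow> real ^ 4 \<Rightarrow> mindex \<Rightarrow> mindex \<Rightarrow> real" where
  "A1 k x = mat_of (mindices k) (A1_action x)"

definition A0 :: "nat \<Rightarrow> (real ^ 2 \<Rightarrow> real ^ 2) \<Rightarrow> real ^ 4 \<Rightarrow> mindex \<Rightarrow> mindex \<Rightarrow> real" where
  "A0 k E x = mat_of (mindices k) (A0_action k E x)"

definition proj_x :: "(mindex \<Rightarrow> real) \<Rightarrow> real ^ 4" where
  "proj_x v = (\<chi> i. v (munit i))"

text \<open>\<open>\<nu>\<close> is \<open>0\<close> or \<open>1\<close>; \<open>dt\<close> is \<open>T / N\<close>, so that the step in the time variable of the problem
  on \<open>[0, T / \<epsilon>^\<nu>]\<close> is \<open>dt / \<epsilon>^\<nu>\<close>. The initial velocity is \<open>z\<^sub>0\<close>.\<close>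

primrec lle_state ::
  "nat \<Rightarrow> (real ^ 2 \<Rightarrow> real ^ 2) \<Rightarrow> nat \<Rightarrow> real \<Rightarrow> real \<Rightarrow> real ^ 2 \<Rightarrow> real ^ 2 \<Rightarrow> nat \<Rightarrow> real ^ 4" where
  "lle_state k E \<nu> \<epsilon> dt y\<^sub>0 z\<^sub>0 0 = vector [y\<^sub>0 $ 1, y\<^sub>0 $ 2, \<epsilon> * z\<^sub>0 $ 1, \<epsilon> * z\<^sub>0 $ 2]"
| "lle_state k E \<nu> \<epsilon> dt y\<^sub>0 z\<^sub>0 (Suc n) =
     (let X = lle_state k E \<nu> \<epsilon> dt y\<^sub>0 z\<^sub>0 n;
          M = (\<lambda>\<alpha> \<gamma>. (\<epsilon> powi (- 1 - int \<nu>) * A1 k X \<alpha> \<gamma> + \<epsilon> powi (1 - int \<nu>) * A0 k E X \<alpha> \<gamma>) * dt)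
      in X + proj_x (mat_app (mindices k) (mat_exp (mindices k) M) (unit_vec 0)))"

definition lle_position ::
  "nat \<Rightarrow> (real ^ 2 \<Rightarrow> real ^ 2) \<Rightarrow> nat \<Rightarrow> real \<Rightarrow> real \<Rightarrow> real ^ 2 \<Rightarrow> real ^ 2 \<Rightarrow> nat \<Rightarrow> real ^ 2" where
  "lle_position k E \<nu> \<epsilon> dt y\<^sub>0 z\<^sub>0 n = position_part (lle_state k E \<nu> \<epsilon> dt y\<^sub>0 z\<^sub>0 n)"

definition lle_velocity ::
  "nat \<Rightarrow> (real ^ 2 \<Rightarrow> real ^ 2) \<Rightarrow> nat \<Rightarrow> real \<Rightarrow> real \<Rightarrow> real ^ 2 \<Rightarrow> real ^ 2 \<Rightarrow> nat \<Rightarrow> real ^ 2" where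
  "lle_velocity k E \<nu> \<epsilon> dt y\<^sub>0 z\<^sub>0 n =
     (let X = lle_state k E \<nu> \<epsilon> dt y\<^sub>0 z\<^sub>0 n in (1 / \<epsilon>) *\<^sub>R vector [X $ 3, X $ 4])"


definition J :: "real ^ 2 ^ 2" where
  "J = vector [vector [0, 1], vector [- 1, 0]]"

text \<open>\<open>y\<close> is the solution on \<open>[0, T]\<close> and \<open>z\<close> its velocity; at the endpoints the derivatives are
  one-sided.\<close>

definition cpd_solution ::
  "(real ^ 2 \<Rightarrow> real ^ 2) \<Rightarrow> real \<Rightarrow> real \<Rightarrow> real ^ 2 \<Rightarrow> real ^ 2 \<Rightarrow>
   (real \<Rightarrow> real ^ 2) \<Rightarrow> (real \<Rightarrow> real ^ 2) \<Rightarrow> bool" where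
  "cpd_solution E \<epsilon> T y\<^sub>0 z\<^sub>0 y z \<longleftrightarrow>
     (\<forall>t\<in>{0..T}. (y has_vector_derivative z t) (at t within {0..T})
        \<and> (z has_vector_derivative (1 / \<epsilon>) *\<^sub>R (J *v z t) + E (y t)) (at t within {0..T}))
     \<and> y 0 = y\<^sub>0 \<and> z 0 = z\<^sub>0"


lemma vector_4 [simp]:
  fixes a b c d :: "'a::zero"
  shows "(vector [a, b, c, d] :: 'a ^ 4) $ 1 = a" "(vector [a, b, c, d] :: 'a ^ 4) $ 2 = b"
    "(vector [a, b, c, d] :: 'a ^ 4) $ 3 = c" "(vector [a, b, c, d] :: 'a ^ 4) $ 4 = d"
  unfolding vector_def by simp_all

lemma finite_mindices: "finite (mindices k)"
proof -
  let ?f = "\<lambda>(a, b, c, d). vector [a, b, c, d] :: mindex"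
  have "mindices k \<subseteq> ?f ` ({..k} \<times> {..k} \<times> {..k} \<times> {..k})"
  proof
    fix \<alpha> assume "\<alpha> \<in> mindices k"
    then have "(\<alpha> $ 1, \<alpha> $ 2, \<alpha> $ 3, \<alpha> $ 4) \<in> {..k} \<times> {..k} \<times> {..k} \<times> {..k}"
      by (auto simp: mindices_def mlen_def)
    moreover have "\<alpha> = ?f (\<alpha> $ 1, \<alpha> $ 2, \<alpha> $ 3, \<alpha> $ 4)"
      by (simp add: vec_eq_iff forall_4)
    ultimately show "\<alpha> \<in> ?f ` ({..k} \<times> {..k} \<times> {..k} \<times> {..k})"
      by (rule rev_image_eqI)
  qed
  then show ?thesis by (rule finite_subset) simp
qed

lemma sum_unit_vec:
  assumes "finite S" "c = 0 \<or> \<delta> \<in> S"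
  shows "(\<Sum>\<gamma>\<in>S. c * unit_vec \<gamma> \<delta> * v \<gamma>) = c * v \<delta>"
proof -
  have "(\<Sum>\<gamma>\<in>S. c * unit_vec \<gamma> \<delta> * v \<gamma>) = (\<Sum>\<gamma>\<in>S. if \<delta> = \<gamma> then c * v \<gamma> else 0)"
    by (intro sum.cong) (auto simp: unit_vec_def)
  then show ?thesis using assms by (auto simp: sum.delta)
qed

lemma mat_app_A1:
  assumes "\<alpha> \<in> mindices k"
  shows "mat_app (mindices k) (A1 k x) v \<alpha> = A1_action x v \<alpha>"
proof -
  let ?S = "mindices k"
  note fin = finite_mindices[of k]
  have mem: "real (\<alpha> $ 1) = 0 \<or> \<alpha> - munit 1 + munit 3 \<in> ?S"
    "real (\<alpha> $ 2) = 0 \<or> \<alpha> - munit 2 + munit 4 \<in> ?S"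
    "real (\<alpha> $ 1) * x $ 3 = 0 \<or> \<alpha> - munit 1 \<in> ?S" "real (\<alpha> $ 2) * x $ 4 = 0 \<or> \<alpha> - munit 2 \<in> ?S"
    "real (\<alpha> $ 3) = 0 \<or> \<alpha> - munit 3 + munit 4 \<in> ?S"
    "real (\<alpha> $ 4) = 0 \<or> \<alpha> - munit 4 + munit 3 \<in> ?S"
    "real (\<alpha> $ 3) * x $ 4 = 0 \<or> \<alpha> - munit 3 \<in> ?S" "real (\<alpha> $ 4) * x $ 3 = 0 \<or> \<alpha> - munit 4 \<in> ?S"
    using assms by (auto simp: mindices_def mlen_def axis_def)
  have "mat_app ?S (A1 k x) v \<alpha> = (\<Sum>\<gamma>\<in>?S. A1_action x (unit_vec \<gamma>) \<alpha> * v \<gamma>)"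
    using assms by (auto simp: mat_app_def A1_def mat_of_def)
  also have "\<dots> = A1_action x v \<alpha>"
    unfolding A1_action_def distrib_right left_diff_distrib sum.distrib sum_subtractf
    by (simp only: sum_unit_vec[OF fin mem(1)] sum_unit_vec[OF fin mem(2)]
        sum_unit_vec[OF fin mem(3)] sum_unit_vec[OF fin mem(4)] sum_unit_vec[OF fin mem(5)]
        sum_unit_vec[OF fin mem(6)] sum_unit_vec[OF fin mem(7)] sum_unit_vec[OF fin mem(8)])
  finally show ?thesis .
qed

lemma mat_app_A0:
  assumes "\<alpha> \<in> mindices k"
  shows "mat_app (mindices k) (A0 k E x) v \<alpha> = A0_action k E x v \<alpha>"
proof -
  let ?S = "mindices k"
  let ?B = "{\<beta>::mindex. \<beta> $ 3 = 0 \<and> \<beta> $ 4 = 0 \<and> mlen \<beta> \<le> k - mlen \<alpha> + 1}"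
  note fin = finite_mindices[of k]
  have "mat_app ?S (A0 k E x) v \<alpha> = (\<Sum>\<gamma>\<in>?S. A0_action k E x (unit_vec \<gamma>) \<alpha> * v \<gamma>)"
    using assms by (auto simp: mat_app_def A0_def mat_of_def)
  also have "\<dots> = A0_action k E x v \<alpha>"
    unfolding A0_action_def sum_distrib_right
  proof (subst sum.swap, rule sum.cong[OF refl])
    fix \<beta> assume \<beta>: "\<beta> \<in> ?B"
    let ?f = "1 / (fact (\<beta> $ 1) * fact (\<beta> $ 2)) :: real"
    let ?p = "\<lambda>i. partials (\<beta> $ 1) (\<beta> $ 2) (\<lambda>y. E y $ i) (position_part x)"
    have m3: "?f * (real (\<alpha> $ 3) * ?p 1) = 0 \<or> \<alpha> + \<beta> - munit 3 \<in> ?S"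
      and m4: "?f * (real (\<alpha> $ 4) * ?p 2) = 0 \<or> \<alpha> + \<beta> - munit 4 \<in> ?S"
      using assms \<beta> by (auto simp: mindices_def mlen_def axis_def)
    show "(\<Sum>\<gamma>\<in>?S. ?f * (real (\<alpha> $ 3) * ?p 1 * unit_vec \<gamma> (\<alpha> + \<beta> - munit 3)
              + real (\<alpha> $ 4) * ?p 2 * unit_vec \<gamma> (\<alpha> + \<beta> - munit 4)) * v \<gamma>)
      = ?f * (real (\<alpha> $ 3) * ?p 1 * v (\<alpha> + \<beta> - munit 3) + real (\<alpha> $ 4) * ?p 2 * v (\<alpha> + \<beta> - munit 4))"
      using sum_unit_vec[OF fin m3, of v] sum_unit_vec[OF fin m4, of v]
      by (simp only: distrib_left distrib_right sum.distrib mult.assoc)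
  qed
  finally show ?thesis .
qed

end

theory Submission
  imports Defs
begin

text \<open>
  In the state variable \<open>x = (y, \<epsilon> z)\<close> the fast linear part of the equation conserves the guiding
  centre \<open>(x\<^sub>1 + x\<^sub>4, x\<^sub>2 - x\<^sub>3)\<close> and rotates \<open>(x\<^sub>3, x\<^sub>4)\<close> with frequency \<open>1 / \<epsilon>\<close>, so over
  the whole time interval \<open>x\<close> moves by \<open>O(\<epsilon>)\<close>, and over one step by \<open>O(m)\<close> with
  \<open>m = min \<epsilon> h\<close>. The monomials \<open>(x(t) - x(t\<^sub>n))\<^sup>\<alpha>\<close> therefore solve the linear system of the scheme,
  frozen at \<open>x(t\<^sub>n)\<close>, up to a Taylor remainder \<open>\<epsilon> O(m\<^bsup>k+1\<^esup>)\<close>.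

  Let \<open>D\<close> be their difference from the numerical vector, which is frozen at the numerical state
  \<open>X\<^sub>n\<close>. The part of \<open>A\<^sub>1\<close> that preserves the degree is diagonalised, with purely imaginary
  spectrum, by products of the linear eigenforms of the fast flow; the part that lowers the degree
  has coefficients \<open>O(\<epsilon>)\<close>. Hence a Gronwall argument gives
  \<open>D = O(e\<^sub>n / \<epsilon> + \<epsilon> m\<^bsup>k+1\<^esup>)\<close>, where \<open>e\<^sub>n\<close> is the error at \<open>t\<^sub>n\<close>. In the degree one components,
  which contain the error itself, \<open>D\<close> enters through the slow part only, with a factor \<open>\<epsilon>\<close>. In a norm
  that the fast flow preserves this yields
  \<open>e\<^bsub>n+1\<^esub> \<le> e\<^sub>n + C h (e\<^sub>n + \<epsilon> m\<^bsup>k+1\<^esup>)\<close>, and so \<open>e\<^sub>n = O(\<epsilon> m\<^bsup>k+1\<^esup>)\<close>.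
\<close>

section \<open>The matrix exponential\<close>

lemma mat_pow_scale: "mat_pow S (\<lambda>i j. M i j * t) n i j = mat_pow S M n i j * t ^ n"
  by (induction n arbitrary: i) (simp_all add: sum_distrib_left sum_distrib_right mult_ac)

text \<open>The sum of all absolute entries dominates every row sum, so each factor of
  \<open>M\<close> costs at most this constant. The resulting geometric bound makes the exponential
  series converge entrywise.\<close>

lemma mat_pow_bound:
  assumes "finite S" "i \<in> S"
  shows "\<bar>mat_pow S M n i j\<bar> \<le> (\<Sum>a\<in>S. \<Sum>b\<in>S. \<bar>M a b\<bar>) ^ n"
  using assms(2)
proof (induction n arbitrary: i)
  case (Suc n)
  let ?c = "\<Sum>a\<in>S. \<Sum>b\<in>S. \<bar>M a b\<bar>"
  have "\<bar>mat_pow S M (Suc n) i j\<bar> \<le> (\<Sum>l\<in>S. \<bar>M i l\<bar> * \<bar>mat_pow S M n l j\<bar>)"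
    by (simp add: sum_abs[THEN order_trans] abs_mult flip: abs_mult)
  also have "\<dots> \<le> (\<Sum>l\<in>S. \<bar>M i l\<bar> * ?c ^ n)"
    by (intro sum_mono mult_left_mono Suc.IH) auto
  also have "\<dots> = (\<Sum>l\<in>S. \<bar>M i l\<bar>) * ?c ^ n"
    by (simp add: sum_distrib_right)
  also have "\<dots> \<le> ?c * ?c ^ n"
    using \<open>finite S\<close> \<open>i \<in> S\<close>
    by (intro mult_right_mono member_le_sum[where f = "\<lambda>a. \<Sum>b\<in>S. \<bar>M a b\<bar>"] zero_le_power sum_nonneg) auto
  finally show ?case by simp
qed simp

text \<open>Each entry is an everywhere convergent power series in \<open>t\<close> and may be
  differentiated termwise. The recursion of \<open>mat_pow\<close> splits off one factor
  \<open>M\<close> on the left, which gives the linear differential equation.\<close>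

lemma mat_exp_has_derivative:
  assumes S: "finite S" "i \<in> S"
  shows "((\<lambda>t. mat_exp S (\<lambda>a b. M a b * t) i j) has_real_derivative
           mat_app S M (\<lambda>l. mat_exp S (\<lambda>a b. M a b * t) l j) i) (at t)"
proof -
  define c where "c = (\<lambda>i n. mat_pow S M n i j / fact n)"
  let ?K = "\<Sum>a\<in>S. \<Sum>b\<in>S. \<bar>M a b\<bar>"
  have sm: "summable (\<lambda>n. c i n * x ^ n)" if "i \<in> S" for i x
  proof (rule summable_comparison_test'[where N = 0])
    show "summable (\<lambda>n. inverse (fact n) * (?K * \<bar>x\<bar>) ^ n)"
      by (rule summable_exp)
    show "norm (c i n * x ^ n) \<le> inverse (fact n) * (?K * \<bar>x\<bar>) ^ n" for n
    proof -
      have "\<bar>mat_pow S M n i j\<bar> * \<bar>x\<bar> ^ n \<le> ?K ^ n * \<bar>x\<bar> ^ n"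
        by (intro mult_right_mono mat_pow_bound S that) auto
      then show ?thesis
        by (simp add: c_def abs_mult power_abs power_mult_distrib field_simps)
    qed
  qed
  have e: "mat_exp S (\<lambda>a b. M a b * x) i j = (\<Sum>n. c i n * x ^ n)" for i x
    by (simp only: mat_exp_def mat_pow_scale c_def times_divide_eq_left)
  \<comment> \<open>Differentiation multiplies the coefficient by \<open>n + 1\<close>, which turns
    \<open>fact (n + 1)\<close> into \<open>fact n\<close>.\<close>
  have d: "diffs (c i) n = (\<Sum>l\<in>S. M i l * c l n)" for n
    by (simp add: diffs_def c_def sum_divide_distrib sum_distrib_left del: of_nat_Suc)
  have "((\<lambda>x. \<Sum>n. c i n * x ^ n) has_real_derivative (\<Sum>n. diffs (c i) n * t ^ n)) (at t)"
    by (rule termdiffs_strong_converges_everywhere) (rule sm[OF S(2)])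
  moreover have "(\<Sum>n. diffs (c i) n * t ^ n) = (\<Sum>n. \<Sum>l\<in>S. M i l * (c l n * t ^ n))"
    by (simp add: d sum_distrib_right mult.assoc)
  also have "\<dots> = (\<Sum>l\<in>S. \<Sum>n. M i l * (c l n * t ^ n))"
    by (rule suminf_sum) (intro summable_mult sm)
  also have "\<dots> = (\<Sum>l\<in>S. M i l * (\<Sum>n. c l n * t ^ n))"
    by (intro sum.cong refl suminf_mult sm)
  ultimately show ?thesis
    by (simp add: e mat_app_def)
qed

lemma mat_exp_zero: "mat_exp S (\<lambda>a b. M a b * 0) i j = unit_vec j i"
proof -
  have "mat_exp S (\<lambda>a b. M a b * 0) i j = (\<Sum>n. (mat_pow S M n i j / fact n) * 0 ^ n)"
    unfolding mat_exp_def mat_pow_scale by simp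
  also have "\<dots> = unit_vec j i"
    by (simp only: powser_zero) (simp add: unit_vec_def)
  finally show ?thesis .
qed

lemma mat_app_unit_vec: "finite S \<Longrightarrow> j \<in> S \<Longrightarrow> mat_app S M (unit_vec j) i = M i j"
  by (simp add: mat_app_def unit_vec_def if_distrib[where f = "\<lambda>x. _ * x"] cong: if_cong)

section \<open>The fast linear flow on functionals of polynomials\<close>

text \<open>Multi-indices \<open>axis i 1\<close> would otherwise be rewritten to \<open>axis i (Suc 0)\<close>.\<close>

declare One_nat_def [simp del]

text \<open>The degree-preserving part of \<open>A1_action\<close>. It is polymorphic because it
  acts both on the real vectors of the scheme and on their complex images under multiplication by
  eigenforms.\<close>

definition rot :: "(mindex \<Rightarrow> 'a) \<Rightarrow> mindex \<Rightarrow> 'a::comm_ring_1" where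
  "rot F \<alpha> = of_nat (\<alpha> $ 1) * F (\<alpha> - munit 1 + munit 3) + of_nat (\<alpha> $ 2) * F (\<alpha> - munit 2 + munit 4)
     + of_nat (\<alpha> $ 3) * F (\<alpha> - munit 3 + munit 4) - of_nat (\<alpha> $ 4) * F (\<alpha> - munit 4 + munit 3)"

definition lower :: "real ^ 4 \<Rightarrow> (mindex \<Rightarrow> real) \<Rightarrow> mindex \<Rightarrow> real" where
  "lower x v \<alpha> = real (\<alpha> $ 1) * x $ 3 * v (\<alpha> - munit 1) + real (\<alpha> $ 2) * x $ 4 * v (\<alpha> - munit 2)
     + real (\<alpha> $ 3) * x $ 4 * v (\<alpha> - munit 3) - real (\<alpha> $ 4) * x $ 3 * v (\<alpha> - munit 4)"

lemma A1_action_eq: "A1_action x v \<alpha> = rot v \<alpha> + lower x v \<alpha>"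
  by (simp add: A1_action_def rot_def lower_def)

text \<open>A vector \<open>F\<close> is read as the linear functional \<open>\<xi>\<^sup>\<alpha> \<mapsto> F \<alpha>\<close> on polynomials; \<open>mulq q F\<close> is this functional
  applied after multiplication by the linear form with coefficients \<open>q\<close>, and \<open>rot F\<close> is \<open>F\<close> after
  the derivation given by the fast linear flow.\<close>

definition mulq :: "complex ^ 4 \<Rightarrow> (mindex \<Rightarrow> complex) \<Rightarrow> mindex \<Rightarrow> complex" where
  "mulq q F \<alpha> = (\<Sum>i\<in>UNIV. q $ i * F (\<alpha> + munit i))"

section \<open>Leibniz rule and eigenforms of the fast flow\<close>

lemma mindex_shift:
  fixes \<alpha> :: mindex
  shows "\<alpha> + munit i - munit i = \<alpha>"
    and "\<alpha> $ j > 0 \<Longrightarrow> \<alpha> + munit i - munit j = \<alpha> - munit j + munit i"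
  by (auto simp: vec_eq_iff axis_def)

lemma axis_nth_neq: "i \<noteq> j \<Longrightarrow> axis i x $ j = 0"
  by (simp add: axis_def)

text \<open>Product rule for a partial derivative of a monomial multiplied by the
  \<open>i\<close>-th coordinate; the last summand is the derivative of that coordinate. Where the
  subtraction truncates, the coefficient vanishes.\<close>

lemma add_shift:
  fixes F :: "mindex \<Rightarrow> complex"
  shows "of_nat ((\<alpha> + munit i) $ j) * F (\<alpha> + munit i - munit j + \<gamma>) =
    of_nat (\<alpha> $ j) * F (\<alpha> - munit j + \<gamma> + munit i) + (if i = j then F (\<alpha> + \<gamma>) else 0)"
proof (cases "\<alpha> $ j = 0")
  case False
  then have "\<alpha> + munit i - munit j + \<gamma> = \<alpha> - munit j + \<gamma> + munit i"
    by (simp add: mindex_shift add_ac)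
  moreover have "i = j \<Longrightarrow> \<alpha> + munit i - munit j = \<alpha>"
    by (simp add: mindex_shift)
  ultimately show ?thesis 
    by (auto simp: algebra_simps axis_nth_neq)
qed (auto simp: mindex_shift axis_nth_neq)

lemma rot_shift:
  fixes F :: "mindex \<Rightarrow> complex"
  shows "rot F (\<alpha> + munit i) = rot (\<lambda>\<alpha>. F (\<alpha> + munit i)) \<alpha>
    + (if i = 1 then F (\<alpha> + munit 3) else 0) + (if i = 2 then F (\<alpha> + munit 4) else 0)
    + (if i = 3 then F (\<alpha> + munit 4) else 0) - (if i = 4 then F (\<alpha> + munit 3) else 0)"
  unfolding rot_def add_shift by (simp add: add_ac)

text \<open>The first two forms are the components of the guiding centre, conserved by the fast
  flow. The other two diagonalise the rotation of the third and fourth coordinates. Together they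
  are a basis of the linear forms.\<close>

definition eigvecs :: "(complex ^ 4) set" where
  "eigvecs = {vector [1, 0, 0, 1], vector [0, 1, - 1, 0], vector [0, 0, \<i>, 1], vector [0, 0, - \<i>, 1]}"

text \<open>On the four eigenforms this takes the values 0, 0, 1 and -1; the eigenvalue itself is
  \<open>\<i>\<close> times it.\<close>

definition eigval :: "complex ^ 4 \<Rightarrow> real" where
  "eigval q = Im (q $ 3)"

text \<open>The derivation applied to a product of the form \<open>q\<close> and a monomial is a sum
  of two terms. In one of them it hits the monomial, in the other it hits \<open>q\<close> and
  reproduces it up to the eigenvalue.\<close>

lemma mulq_rot:
  assumes "q \<in> eigvecs"
  shows "mulq q (rot F) \<alpha> = rot (mulq q F) \<alpha> + \<i> * eigval q * mulq q F \<alpha>"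
proof -
  have "mulq q (rot F) \<alpha> = rot (mulq q F) \<alpha> + ((q $ 1 - q $ 4) * F (\<alpha> + munit 3) + (q $ 2 + q $ 3) * F (\<alpha> + munit 4))"
    unfolding mulq_def rot_shift sum_4 by (simp add: rot_def algebra_simps)
  also have "(q $ 1 - q $ 4) * F (\<alpha> + munit 3) + (q $ 2 + q $ 3) * F (\<alpha> + munit 4) = \<i> * eigval q * mulq q F \<alpha>"
    using assms unfolding eigvecs_def eigval_def mulq_def sum_4 by (auto simp: algebra_simps)
  finally show ?thesis .
qed

lemma mulq_linear: "mulq q (\<lambda>\<alpha>. F \<alpha> + c * G \<alpha>) \<alpha> = mulq q F \<alpha> + c * mulq q G \<alpha>"
  by (simp add: mulq_def sum.distrib sum_distrib_left algebra_simps)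

lemma foldr_mulq_linear: 
  "foldr mulq ws (\<lambda>\<alpha>. F \<alpha> + c * G \<alpha>) \<alpha> = foldr mulq ws F \<alpha> + c * foldr mulq ws G \<alpha>"
proof (induction ws arbitrary: \<alpha>)
  case (Cons q ws)
  have "foldr mulq ws (\<lambda>\<alpha>. F \<alpha> + c * G \<alpha>) = (\<lambda>\<alpha>. foldr mulq ws F \<alpha> + c * foldr mulq ws G \<alpha>)"
    using Cons by blast
  then show ?case by (simp add: mulq_linear)
qed simp

lemma foldr_mulq_rot:
  assumes "set ws \<subseteq> eigvecs"
  shows "foldr mulq ws (rot F) \<alpha> = 
    rot (foldr mulq ws F) \<alpha> + \<i> * (\<Sum>q\<leftarrow>ws. eigval q) * foldr mulq ws F \<alpha>"
  using assms
proof (induction ws arbitrary: \<alpha>)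
  case (Cons q ws)
  then have "foldr mulq ws (rot F) = 
    (\<lambda>\<alpha>. rot (foldr mulq ws F) \<alpha> + \<i> * (\<Sum>q\<leftarrow>ws. eigval q) * foldr mulq ws F \<alpha>)"
    by auto
  then show ?case using Cons.prems by (simp add: mulq_linear mulq_rot distrib_right distrib_left)
qed simp

text \<open>A derivation kills constants, so \<open>rot\<close> contributes nothing at 0 and only
  the sum of the eigenvalues survives. Values on products of eigenforms are thus scalar coordinates
  in which the fast flow is diagonal.\<close>

lemma foldr_mulq_rot_0:
  assumes "set ws \<subseteq> eigvecs"
  shows "foldr mulq ws (rot F) 0 = \<i> * (\<Sum>q\<leftarrow>ws. eigval q) * foldr mulq ws F 0"
  by (simp add: foldr_mulq_rot[OF assms] rot_def)

lemma mlen_add: "mlen (\<alpha> + \<beta>) = mlen \<alpha> + mlen \<beta>"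
  by (simp add: mlen_def)

lemma mlen_munit [simp]: "mlen (munit i) = 1"
  using exhaust_4[of i] by (auto simp: mlen_def axis_def)

section \<open>Equivalence of the eigenform coordinates with the components\<close>

lemma mulq_norm_le:
  assumes "q \<in> eigvecs" "\<And>i. norm (F (\<alpha> + munit i)) \<le> U"
  shows "norm (mulq q F \<alpha>) \<le> 2 * U"
proof -
  have "norm (mulq q F \<alpha>) \<le> (\<Sum>i\<in>UNIV. norm (q $ i) * U)"
    unfolding mulq_def by (intro sum_norm_le) (simp add: norm_mult mult_left_mono assms(2))
  also have "\<dots> = 2 * U"
    using assms(1) by (auto simp: eigvecs_def sum_4)
  finally show ?thesis .
qed

lemma foldr_mulq_norm_le:
  assumes "set ws \<subseteq> eigvecs" "\<And>\<alpha>. mlen \<alpha> \<le> k \<Longrightarrow> norm (F \<alpha>) \<le> U" "length ws + mlen \<alpha> \<le> k"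
  shows "norm (foldr mulq ws F \<alpha>) \<le> 2 ^ length ws * U"
  using assms(1,3)
proof (induction ws arbitrary: \<alpha>)
  case (Cons q ws)
  have "norm (mulq q (foldr mulq ws F) \<alpha>) \<le> 2 * (2 ^ length ws * U)"
    using Cons.prems by (intro mulq_norm_le Cons.IH) (auto simp: mlen_add)
  then show ?case by simp
qed (use assms(2) in simp)

lemma mulq_recover:
  shows "F (\<alpha> + munit 4) = (mulq (vector [0, 0, \<i>, 1]) F \<alpha> + mulq (vector [0, 0, - \<i>, 1]) F \<alpha>) / 2"
    and "F (\<alpha> + munit 3) = (mulq (vector [0, 0, - \<i>, 1]) F \<alpha> - mulq (vector [0, 0, \<i>, 1]) F \<alpha>) * \<i> / 2"
    and "F (\<alpha> + munit 1) = mulq (vector [1, 0, 0, 1]) F \<alpha> - F (\<alpha> + munit 4)"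
    and "F (\<alpha> + munit 2) = mulq (vector [0, 1, -1, 0]) F \<alpha> + F (\<alpha> + munit 3)"
  by (auto simp: mulq_def sum_4 algebra_simps)

lemma mulq_norm_ge:
  assumes "\<And>q. q \<in> eigvecs \<Longrightarrow> norm (mulq q F \<alpha>) \<le> U"
  shows "norm (F (\<alpha> + munit i)) \<le> 2 * U"
proof -
  have b: "norm (mulq (vector [1, 0, 0, 1]) F \<alpha>) \<le> U" "norm (mulq (vector [0, 1, -1, 0]) F \<alpha>) \<le> U"
    "norm (mulq (vector [0, 0, \<i>, 1]) F \<alpha>) \<le> U" "norm (mulq (vector [0, 0, - \<i>, 1]) F \<alpha>) \<le> U"
    by (auto intro!: assms simp: eigvecs_def)
  have U: "U \<ge> 0" using order_trans[OF norm_ge_zero b(1)] .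
  have 4: "norm (F (\<alpha> + munit 4)) \<le> U"
    unfolding mulq_recover(1) norm_divide using norm_triangle_le[OF add_mono[OF b(3) b(4)]] by simp
  have 3: "norm (F (\<alpha> + munit 3)) \<le> U"
    unfolding mulq_recover(2) norm_divide norm_mult 
    using norm_triangle_le_diff[OF add_mono[OF b(4) b(3)]] by simp
  have 1: "norm (F (\<alpha> + munit 1)) \<le> U + U"
    unfolding mulq_recover(3) using b 4 by (intro norm_triangle_le_diff add_mono) auto
  have 2: "norm (F (\<alpha> + munit 2)) \<le> U + U"
    unfolding mulq_recover(4) using b 3 by (intro norm_triangle_le add_mono) auto
  from 1 2 3 4 U exhaust_4[of i] show ?thesis by (auto intro: order_trans)
qed

lemma mindex_cases:
  obtains "\<alpha> = (0::mindex)" | i \<beta> where "\<alpha> = \<beta> + munit i"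
proof (cases "\<alpha> = 0")
  case False
  then obtain i where "\<alpha> $ i \<noteq> 0" by (auto simp: vec_eq_iff)
  then have "\<alpha> = (\<alpha> - munit i) + munit i" by (auto simp: vec_eq_iff axis_def)
  then show ?thesis using that by blast
qed (use that in blast)

text \<open>Induction on the degree of \<open>\<alpha>\<close>: one unit of \<open>\<alpha>\<close>
  is exchanged for one more eigenform in the list, at the cost of a factor 2. The list
  \<open>ws\<close> is arbitrary because it grows along the way.\<close>

lemma foldr_mulq_norm_ge:
  assumes "\<And>ws. set ws \<subseteq> eigvecs \<Longrightarrow> length ws \<le> k \<Longrightarrow> norm (foldr mulq ws F 0) \<le> U"
    and "set ws \<subseteq> eigvecs" "length ws + mlen \<alpha> \<le> k"
  shows "norm (foldr mulq ws F \<alpha>) \<le> 2 ^ mlen \<alpha> * U"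
  using assms(2,3)
proof (induction "mlen \<alpha>" arbitrary: \<alpha> ws)
  case 0
  then have "\<alpha> = 0" by (auto simp: mlen_def vec_eq_iff forall_4)
  then show ?case using assms(1) 0 by simp
next
  case (Suc n)
  show ?case
  proof (cases \<alpha> rule: mindex_cases)
    case 1
    then show ?thesis using Suc by (simp add: mlen_def)
  next
    case (2 i \<beta>)
    then have n: "n = mlen \<beta>" using Suc.hyps(2) by (simp add: mlen_add)
    have "norm (foldr mulq ws F (\<beta> + munit i)) \<le> 2 * (2 ^ n * U)"
    proof (rule mulq_norm_ge)
      fix q assume q: "q \<in> eigvecs"
      show "norm (mulq q (foldr mulq ws F) \<beta>) \<le> 2 ^ n * U"
        using Suc.hyps(1)[OF n, of "q # ws"] Suc.prems q n Suc.hyps(2) by simp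
    qed
    then show ?thesis using 2 by (simp add: mlen_add n power_add)
  qed
qed

section \<open>Energy estimates for the propagator\<close>

lemma gronwall_quadratic:
  fixes S :: "real \<Rightarrow> real"
  assumes "a \<le> b" "\<kappa> > 0"
    and der: "\<And>t. t \<in> {a..b} \<Longrightarrow> (S has_vector_derivative S' t) (at t within {a..b})"
    and le: "\<And>t. t \<in> {a..b} \<Longrightarrow> S' t \<le> \<kappa> * (S t + \<mu>)"
  shows "S b + \<mu> \<le> exp (\<kappa> * (b - a)) * (S a + \<mu>)"
proof -
  \<comment> \<open>The integrating factor is applied to \<open>S\<close> shifted by
    \<open>\<mu>\<close>, which makes the inhomogeneous inequality homogeneous.\<close>
  let ?g = "\<lambda>t. exp (- \<kappa> * t) * (S t + \<mu>)"
  have d: "(?g has_real_derivative exp (- \<kappa> * t) * (S' t - \<kappa> * (S t + \<mu>))) (at t within {a..b})"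
    if "t \<in> {a..b}" for t
    using der[OF that] unfolding has_real_derivative_iff_has_vector_derivative[symmetric]
    by (auto intro!: derivative_eq_intros simp: algebra_simps)
  have "?g b \<le> ?g a"
  proof (rule DERIV_nonpos_imp_decreasing_open[OF assms(1)])
    show "continuous_on {a..b} ?g"
      using DERIV_continuous_on[OF d] by blast
    fix t assume t: "a < t" "t < b"
    then have "(?g has_real_derivative exp (- \<kappa> * t) * (S' t - \<kappa> * (S t + \<mu>))) (at t)"
      using d[of t] at_within_Icc_at[of a t b] by auto
    moreover have "exp (- \<kappa> * t) * (S' t - \<kappa> * (S t + \<mu>)) \<le> 0"
      using le[of t] t by (simp add: mult_le_0_iff)
    ultimately show "\<exists>y. (?g has_real_derivative y) (at t) \<and> y \<le> 0" by blast
  qed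
  then have "exp (\<kappa> * b) * exp (- \<kappa> * b) * (S b + \<mu>) \<le> exp (\<kappa> * b) * exp (- \<kappa> * a) * (S a + \<mu>)" 
    by (simp add: mult.assoc)
  moreover have e: "exp (\<kappa> * b) * exp (- \<kappa> * b) = 1" "exp (\<kappa> * b) * exp (- \<kappa> * a) = exp (\<kappa> * (b - a))"
    by (simp_all flip: exp_add add: algebra_simps)
  ultimately show ?thesis unfolding e by simp
qed

lemma mulq_has_derivative:
  assumes "\<And>i. ((\<lambda>t. F t (\<alpha> + munit i)) has_vector_derivative F' (\<alpha> + munit i)) net"
  shows "((\<lambda>t. mulq q (F t) \<alpha>) has_vector_derivative mulq q F' \<alpha>) net"
  unfolding mulq_def
  by (intro has_vector_derivative_sum has_vector_derivative_mult_right assms)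

lemma foldr_mulq_has_derivative:
  assumes "\<And>\<alpha>. mlen \<alpha> \<le> k \<Longrightarrow> ((\<lambda>t. F t \<alpha>) has_vector_derivative F' \<alpha>) net" 
    "length ws + mlen \<alpha> \<le> k"
  shows "((\<lambda>t. foldr mulq ws (F t) \<alpha>) has_vector_derivative foldr mulq ws F' \<alpha>) net"
  using assms(2)
proof (induction ws arbitrary: \<alpha>)
  case (Cons q ws)
  have "((\<lambda>t. mulq q (foldr mulq ws (F t)) \<alpha>) has_vector_derivative mulq q (foldr mulq ws F') \<alpha>) net"
    using Cons.prems by (intro mulq_has_derivative Cons.IH) (simp add: mlen_add)
  then show ?case by simp
qed (use assms(1) in simp)

text \<open>The rotating term is orthogonal to \<open>g t\<close>, so the frequency, later of size
  \<open>1 / \<epsilon>\<close>, does not enter the growth rate.\<close>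

lemma norm_sq_derivative_rotating:
  fixes g :: "real \<Rightarrow> complex"
  assumes "(g has_vector_derivative \<i> * of_real \<omega> * g t + p) (at t within A)"
  shows "\<exists>d. ((\<lambda>t. (norm (g t))\<^sup>2) has_vector_derivative d) (at t within A) 
    \<and> d \<le> (norm (g t))\<^sup>2 + (norm p)\<^sup>2"
proof (intro exI conjI)
  let ?g' = "\<i> * of_real \<omega> * g t + p"
  have "((\<lambda>t. g t \<bullet> g t) has_derivative (\<lambda>s. g t \<bullet> (s *\<^sub>R ?g') + (s *\<^sub>R ?g') \<bullet> g t)) (at t within A)"
    using assms unfolding has_vector_derivative_def by (intro has_derivative_inner) auto
  then show "((\<lambda>t. (norm (g t))\<^sup>2) has_vector_derivative 2 * (g t \<bullet> ?g')) (at t within A)"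
    by (simp add: has_vector_derivative_def power2_norm_eq_inner inner_commute algebra_simps)
  have "g t \<bullet> ?g' = g t \<bullet> p"
    by (simp add: inner_complex_def algebra_simps)
  also have "2 * \<dots> \<le> 2 * (norm (g t) * norm p)"
    by (simp add: norm_cauchy_schwarz)
  also have "\<dots> \<le> (norm (g t))\<^sup>2 + (norm p)\<^sup>2"
    using sum_squares_bound[of "norm (g t)" "norm p"] by (simp add: mult.assoc)
  finally show "2 * (g t \<bullet> ?g') \<le> (norm (g t))\<^sup>2 + (norm p)\<^sup>2" by simp
qed

lemma finite_eigvecs: "finite eigvecs"
  by (simp add: eigvecs_def)

text \<open>In the coordinates given by products of eigenforms the fast part is a pure rotation, so
  Gronwall applied to the sum of their squares gives a constant that does not depend on
  \<open>\<epsilon>\<close>. The condition on \<open>f\<close> bounds it at each time by any bound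
  of \<open>u\<close> at that time, and so covers slow terms that couple all components.\<close>

lemma propagator_bound:
  assumes "a \<ge> 0"
  obtains C where "C > 0"
    "\<And>\<epsilon> s h \<rho> u f \<alpha> t. \<lbrakk>h \<le> T; \<rho> \<ge> 0; t \<in> {s..s+h}; mlen \<alpha> \<le> k;
      \<And>\<alpha>. mlen \<alpha> \<le> k \<Longrightarrow> u s \<alpha> = 0;
      \<And>\<alpha> t. t \<in> {s..s+h} \<Longrightarrow> mlen \<alpha> \<le> k \<Longrightarrow> 
        ((\<lambda>t. u t \<alpha>) has_vector_derivative rot (u t) \<alpha> / \<epsilon> + f t \<alpha>) (at t within {s..s+h});
      \<And>\<alpha> t U. t \<in> {s..s+h} \<Longrightarrow> mlen \<alpha> \<le> k \<Longrightarrow> (\<And>\<alpha>. mlen \<alpha> \<le> k \<Longrightarrow> \<bar>u t \<alpha>\<bar> \<le> U) 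
        \<Longrightarrow> \<bar>f t \<alpha>\<bar> \<le> a * U + \<rho>\<rbrakk>
      \<Longrightarrow> \<bar>u t \<alpha>\<bar> \<le> C * (\<rho>::real)"
proof -
  define Ws where "Ws = {ws. set ws \<subseteq> eigvecs \<and> length ws \<le> k}"
  have finW: "finite Ws" unfolding Ws_def by (rule finite_lists_length_le[OF finite_eigvecs])
  define c where "c = real (card Ws)"
  \<comment> \<open>The summand 1 comes from the rotation estimate, the second from the part of
    \<open>f\<close> controlled by \<open>u\<close>, the third from the forcing
    \<open>\<rho>\<close>.\<close>
  define \<kappa> where "\<kappa> = 1 + 2 * c * (2 ^ k * a * 2 ^ k)\<^sup>2 + 2 * c * (2 ^ k)\<^sup>2"
  have \<kappa>: "\<kappa> \<ge> 1" by (simp add: \<kappa>_def c_def)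
  define C where "C = 2 ^ k * exp (\<kappa> * \<bar>T\<bar>)"
  show ?thesis
  proof (rule that)
    show "C > 0" by (simp add: C_def)
    fix \<epsilon> s h \<rho> :: real and u f :: "real \<Rightarrow> mindex \<Rightarrow> real" and \<alpha>0 :: mindex and t0 :: real
    assume hT: "h \<le> T" and \<rho>: "\<rho> \<ge> 0" and t0: "t0 \<in> {s..s+h}" and \<alpha>0: "mlen \<alpha>0 \<le> k"
      and u0: "\<And>\<alpha>. mlen \<alpha> \<le> k \<Longrightarrow> u s \<alpha> = 0"
      and du: "\<And>\<alpha> t. t \<in> {s..s+h} \<Longrightarrow> mlen \<alpha> \<le> k \<Longrightarrow> 
        ((\<lambda>t. u t \<alpha>) has_vector_derivative rot (u t) \<alpha> / \<epsilon> + f t \<alpha>) (at t within {s..s+h})"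
      and f: "\<And>\<alpha> t U. t \<in> {s..s+h} \<Longrightarrow> mlen \<alpha> \<le> k \<Longrightarrow> (\<And>\<alpha>. mlen \<alpha> \<le> k \<Longrightarrow> \<bar>u t \<alpha>\<bar> \<le> U) 
        \<Longrightarrow> \<bar>f t \<alpha>\<bar> \<le> a * U + \<rho>"
    define cu where "cu = (\<lambda>t \<alpha>. complex_of_real (u t \<alpha>))"
    define cf where "cf = (\<lambda>t \<alpha>. complex_of_real (f t \<alpha>))"
    define g where "g = (\<lambda>ws t. foldr mulq ws (cu t) 0)"
    define p where "p = (\<lambda>ws t. foldr mulq ws (cf t) 0)"
    define S where "S = (\<lambda>t. \<Sum>ws\<in>Ws. (norm (g ws t))\<^sup>2)"
    have S0: "S t \<ge> 0" for t unfolding S_def by (intro sum_nonneg) auto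
    \<comment> \<open>Each product of eigenforms obeys a scalar equation with purely imaginary
      frequency and forcing \<open>p ws\<close>.\<close>
    have dg: "(g ws has_vector_derivative 
        \<i> * complex_of_real ((\<Sum>q\<leftarrow>ws. eigval q) / \<epsilon>) * g ws t + p ws t) (at t within {s..s+h})"
      if ws: "ws \<in> Ws" and t: "t \<in> {s..s+h}" for ws t
    proof -
      have "(g ws has_vector_derivative foldr mulq ws (\<lambda>\<alpha>. cf t \<alpha> + complex_of_real (1 / \<epsilon>) * rot (cu t) \<alpha>) 0) (at t within {s..s+h})"
        unfolding g_def
      proof (rule foldr_mulq_has_derivative[where k = k])
        fix \<alpha> assume "mlen \<alpha> \<le> k"
        from has_vector_derivative_of_real[OF du[OF t this, folded has_real_derivative_iff_has_vector_derivative], where ?'a = complex]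
        show "((\<lambda>t. cu t \<alpha>) has_vector_derivative cf t \<alpha> + complex_of_real (1 / \<epsilon>) * rot (cu t) \<alpha>) (at t within {s..s+h})"
          by (simp add: cu_def cf_def rot_def field_simps)
      qed (use ws in \<open>auto simp: Ws_def mlen_def\<close>)
      also have "foldr mulq ws (\<lambda>\<alpha>. cf t \<alpha> + complex_of_real (1 / \<epsilon>) * rot (cu t) \<alpha>) 0 = 
        \<i> * complex_of_real ((\<Sum>q\<leftarrow>ws. eigval q) / \<epsilon>) * g ws t + p ws t"
        using ws unfolding foldr_mulq_linear by (simp add: foldr_mulq_rot_0 Ws_def g_def p_def)
      finally show ?thesis .
    qed
    have uS: "\<bar>u t \<alpha>\<bar> \<le> 2 ^ k * sqrt (S t)" if "mlen \<alpha> \<le> k" for t \<alpha>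
    proof -
      have "norm (foldr mulq [] (cu t) \<alpha>) \<le> 2 ^ mlen \<alpha> * sqrt (S t)"
      proof (rule foldr_mulq_norm_ge)
        fix ws :: "(complex ^ 4) list" assume "set ws \<subseteq> eigvecs" "length ws \<le> k"
        then have "(norm (g ws t))\<^sup>2 \<le> S t"
          unfolding S_def using finW by (intro member_le_sum) (auto simp: Ws_def)
        then show "norm (foldr mulq ws (cu t) 0) \<le> sqrt (S t)"
          by (simp add: g_def real_le_rsqrt)
      qed (use that in auto)
      also have "\<dots> \<le> 2 ^ k * sqrt (S t)"
        using that S0 by (intro mult_right_mono power_increasing) auto
      finally show ?thesis by (simp add: cu_def)
    qed
    have p: "(norm (p ws t))\<^sup>2 \<le> 2 * (2 ^ k * a * 2 ^ k)\<^sup>2 * S t + 2 * (2 ^ k)\<^sup>2 * \<rho>\<^sup>2"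
      if ws: "ws \<in> Ws" and t: "t \<in> {s..s+h}" for ws t
    proof -
      let ?U = "a * (2 ^ k * sqrt (S t)) + \<rho>"
      have U: "?U \<ge> 0" using assms \<rho> S0 by simp
      have "norm (p ws t) \<le> 2 ^ length ws * ?U"
        unfolding p_def
        by (rule foldr_mulq_norm_le[where k = k]) 
          (use ws f[OF t _ uS] in \<open>auto simp: Ws_def cf_def mlen_def\<close>)
      also have "\<dots> \<le> 2 ^ k * ?U"
        using ws U by (intro mult_right_mono power_increasing) (auto simp: Ws_def)
      finally have "(norm (p ws t))\<^sup>2 \<le> ((2 ^ k * a * 2 ^ k) * sqrt (S t) + 2 ^ k * \<rho>)\<^sup>2"
        by (intro power_mono) (auto simp: algebra_simps)
      also have "\<dots> \<le> 2 * ((2 ^ k * a * 2 ^ k) * sqrt (S t))\<^sup>2 + 2 * (2 ^ k * \<rho>)\<^sup>2"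
        using sum_squares_bound[of "(2 ^ k * a * 2 ^ k) * sqrt (S t)" "2 ^ k * \<rho>"]
        unfolding power2_sum by linarith
      finally show ?thesis using S0 by (simp add: power_mult_distrib)
    qed
    have "\<exists>d. ((\<lambda>t. (norm (g ws t))\<^sup>2) has_vector_derivative d) (at t within {s..s+h}) 
        \<and> d \<le> (norm (g ws t))\<^sup>2 + (norm (p ws t))\<^sup>2" 
      if "ws \<in> Ws" "t \<in> {s..s+h}" for ws t
      by (rule norm_sq_derivative_rotating[OF dg[OF that]])
    then obtain d where d: "\<And>ws t. ws \<in> Ws \<Longrightarrow> t \<in> {s..s+h} \<Longrightarrow> 
        ((\<lambda>t. (norm (g ws t))\<^sup>2) has_vector_derivative d ws t) (at t within {s..s+h})"
      "\<And>ws t. ws \<in> Ws \<Longrightarrow> t \<in> {s..s+h} \<Longrightarrow> d ws t \<le> (norm (g ws t))\<^sup>2 + (norm (p ws t))\<^sup>2"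
      by metis
    have "S t0 + \<rho>\<^sup>2 \<le> exp (\<kappa> * (t0 - s)) * (S s + \<rho>\<^sup>2)"
    proof (rule gronwall_quadratic)
      show "s \<le> t0" "\<kappa> > 0" using t0 \<kappa> by auto
      fix t assume "t \<in> {s..t0}"
      then have t: "t \<in> {s..s+h}" using t0 by auto
      have "(S has_vector_derivative (\<Sum>ws\<in>Ws. d ws t)) (at t within {s..s+h})"
        unfolding S_def by (intro has_vector_derivative_sum d t)
      then show "(S has_vector_derivative (\<Sum>ws\<in>Ws. d ws t)) (at t within {s..t0})"
        using t0 by (rule_tac has_vector_derivative_within_subset) auto
      have "(\<Sum>ws\<in>Ws. d ws t) \<le> (\<Sum>ws\<in>Ws. (norm (g ws t))\<^sup>2 + (2 * (2 ^ k * a * 2 ^ k)\<^sup>2 * S t + 2 * (2 ^ k)\<^sup>2 * \<rho>\<^sup>2))"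
        using d(2)[OF _ t] p[OF _ t] by (intro sum_mono) fastforce
      also have "\<dots> = S t + c * (2 * (2 ^ k * a * 2 ^ k)\<^sup>2 * S t + 2 * (2 ^ k)\<^sup>2 * \<rho>\<^sup>2)"
        by (simp add: sum.distrib S_def c_def)
      also have "\<dots> \<le> \<kappa> * (S t + \<rho>\<^sup>2)"
      proof -
        have "0 \<le> (2 * c * (2 ^ k)\<^sup>2) * S t" "0 \<le> (1 + 2 * c * (2 ^ k * a * 2 ^ k)\<^sup>2) * \<rho>\<^sup>2"
          using S0 by (auto simp: c_def)
        then show ?thesis unfolding \<kappa>_def by (simp add: algebra_simps)
      qed
      finally show "(\<Sum>ws\<in>Ws. d ws t) \<le> \<kappa> * (S t + \<rho>\<^sup>2)" .
    qed
    also have "S s = 0"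
    proof -
      have "g ws s = 0" if "ws \<in> Ws" for ws
        using foldr_mulq_norm_le[of ws k "cu s" 0 0] that u0 by (auto simp: Ws_def cu_def g_def mlen_def)
      then show ?thesis by (simp add: S_def)
    qed
    \<comment> \<open>Enlarging the exponent to \<open>2 * (\<kappa> * \<bar>T\<bar>)\<close> makes
      the factor a square, ready for the square root below.\<close>
    also have "exp (\<kappa> * (t0 - s)) * (0 + \<rho>\<^sup>2) \<le> (exp (\<kappa> * \<bar>T\<bar>))\<^sup>2 * \<rho>\<^sup>2"
    proof -
      have "\<kappa> * (t0 - s) \<le> \<kappa> * (2 * \<bar>T\<bar>)" using \<kappa> t0 hT by (intro mult_left_mono) auto
      then have "exp (\<kappa> * (t0 - s)) \<le> exp (2 * (\<kappa> * \<bar>T\<bar>))" by simp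
      also have "\<dots> = (exp (\<kappa> * \<bar>T\<bar>))\<^sup>2" by (rule exp_double)
      finally show ?thesis by (simp add: mult_right_mono)
    qed
    finally have "S t0 \<le> (exp (\<kappa> * \<bar>T\<bar>) * \<rho>)\<^sup>2" 
      unfolding power_mult_distrib using zero_le_power2[of \<rho>] by linarith
    then have "sqrt (S t0) \<le> exp (\<kappa> * \<bar>T\<bar>) * \<rho>"
      using \<rho> by (simp add: real_le_lsqrt)
    then show "\<bar>u t0 \<alpha>0\<bar> \<le> C * \<rho>"
      using uS[OF \<alpha>0, of t0] unfolding C_def by (simp add: mult.assoc order_trans[OF _ mult_left_mono])
  qed
qed

section \<open>Taylor expansion with Lipschitz remainder\<close>

text \<open>Maclaurin's formula has \<open>d m\<close> at an intermediate point in its last term.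
  Moving that point to 0 costs \<open>L * \<bar>x\<bar>\<close> by the Lipschitz bound, which
  supplies the extra power of \<open>\<bar>x\<bar>\<close> from \<open>m\<close> derivatives
  only.\<close>

lemma taylor_lipschitz:
  fixes d :: "nat \<Rightarrow> real \<Rightarrow> real"
  assumes "\<And>j x. j < m \<Longrightarrow> (d j has_real_derivative d (Suc j) x) (at x)"
    and "L-lipschitz_on UNIV (d m)"
  shows "\<bar>d 0 x - (\<Sum>j\<le>m. d j 0 / fact j * x ^ j)\<bar> \<le> L * \<bar>x\<bar> ^ Suc m"
proof -
  obtain t where t: "\<bar>t\<bar> \<le> \<bar>x\<bar>" "d 0 x = (\<Sum>j<m. d j 0 / fact j * x ^ j) + d m t / fact m * x ^ m"
    using Maclaurin_bi_le[of d "d 0" m x] assms(1) by auto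
  have L: "L \<ge> 0" using assms(2) lipschitz_on_nonneg by blast
  have "{..m} = insert m {..<m}" by auto
  then have "d 0 x - (\<Sum>j\<le>m. d j 0 / fact j * x ^ j) = (d m t - d m 0) / fact m * x ^ m"
    unfolding t(2) by (simp add: field_simps)
  also have "\<bar>\<dots>\<bar> \<le> (L * \<bar>x\<bar>) * \<bar>x\<bar> ^ m"
  proof -
    have "\<bar>d m t - d m 0\<bar> \<le> L * \<bar>t\<bar>"
      using lipschitz_onD[OF assms(2), of t 0] by (simp add: dist_real_def)
    also have "\<dots> \<le> L * \<bar>x\<bar>" using t(1) L by (simp add: mult_left_mono)
    finally have dm: "\<bar>d m t - d m 0\<bar> \<le> L * \<bar>x\<bar>" .
    have "\<bar>(d m t - d m 0) / fact m\<bar> \<le> \<bar>d m t - d m 0\<bar>"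
      using fact_ge_1[of m, where ?'a = real] by (simp add: divide_le_eq mult_le_cancel_left1)
    then show ?thesis 
      unfolding abs_mult power_abs using dm by (intro mult_right_mono) auto
  qed
  finally show ?thesis by simp
qed

text \<open>Differentiability turns the \<open>deriv\<close> at 0 in \<open>partial\<close> into a
  true derivative along the whole coordinate line, where one-dimensional Taylor expansion
  applies.\<close>

lemma partial_has_derivative:
  assumes "f differentiable (at (y + x *\<^sub>R axis j 1))"
  shows "((\<lambda>t. f (y + t *\<^sub>R axis j 1)) has_real_derivative partial j f (y + x *\<^sub>R axis j 1)) (at x)"
proof -
  let ?e = "axis j 1 :: real ^ 2"
  obtain f' where f': "(f has_derivative f') (at (y + x *\<^sub>R ?e))"
    using assms unfolding differentiable_def by blast
  have *: "((\<lambda>t. f (y + x *\<^sub>R ?e + t *\<^sub>R ?e)) has_real_derivative f' ?e) (at 0)"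
  proof -
    have "((\<lambda>t. f (y + x *\<^sub>R ?e + t *\<^sub>R ?e)) has_derivative (\<lambda>t. f' (t *\<^sub>R ?e))) (at 0)"
      by (rule has_derivative_compose[where g = f]) (auto intro!: derivative_eq_intros f')
    moreover have "f' (t *\<^sub>R ?e) = f' ?e * t" for t
      using linear_scale[OF has_derivative_linear[OF f'], of t ?e] by simp
    ultimately show ?thesis by (simp add: has_field_derivative_def)
  qed
  then have "partial j f (y + x *\<^sub>R ?e) = f' ?e"
    unfolding partial_def by (rule DERIV_imp_deriv)
  moreover have "((\<lambda>t. f (y + t *\<^sub>R ?e)) has_real_derivative f' ?e) (at x)"
  proof -
    have "((\<lambda>t. f (y + t *\<^sub>R ?e)) has_derivative (\<lambda>t. f' (t *\<^sub>R ?e))) (at x)"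
      by (rule has_derivative_compose[where g = f]) (auto intro!: derivative_eq_intros f')
    moreover have "f' (t *\<^sub>R ?e) = f' ?e * t" for t
      using linear_scale[OF has_derivative_linear[OF f'], of t ?e] by simp
    ultimately show ?thesis by (simp add: has_field_derivative_def)
  qed
  ultimately show ?thesis by simp
qed

lemma of_class_C_partial_pow:
  "of_class_C (m + b) f \<Longrightarrow> of_class_C m ((partial j ^^ b) f)"
proof (induction b arbitrary: m)
  case (Suc b)
  have "of_class_C (Suc m) ((partial j ^^ b) f)"
    using Suc.prems by (intro Suc.IH) simp
  then show ?case by simp
qed simp

lemma taylor_partial:
  assumes "of_class_C m f" "L-lipschitz_on UNIV ((partial j ^^ m) f)"
  shows "\<bar>f (y + x *\<^sub>R axis j 1) - (\<Sum>b\<le>m. (partial j ^^ b) f y / fact b * x ^ b)\<bar> \<le> L * \<bar>x\<bar> ^ Suc m"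
proof -
  have "\<bar>(\<lambda>x. (partial j ^^ 0) f (y + x *\<^sub>R axis j 1)) x - (\<Sum>b\<le>m. (partial j ^^ b) f (y + 0 *\<^sub>R axis j 1) / fact b * x ^ b)\<bar> \<le> L * \<bar>x\<bar> ^ Suc m"
  proof (rule taylor_lipschitz)
    fix b x assume "b < m"
    then have "of_class_C (Suc (m - Suc b) + b) f" using assms(1) by simp
    then have "of_class_C (Suc (m - Suc b)) ((partial j ^^ b) f)" by (rule of_class_C_partial_pow)
    then show "((\<lambda>x. (partial j ^^ b) f (y + x *\<^sub>R axis j 1)) has_real_derivative (partial j ^^ Suc b) f (y + x *\<^sub>R axis j 1)) (at x)"
      by (auto intro: partial_has_derivative)
  next
    show "L-lipschitz_on UNIV (\<lambda>x. (partial j ^^ m) f (y + x *\<^sub>R axis j 1))"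
    proof (rule lipschitz_onI)
      show "L \<ge> 0" using assms(2) lipschitz_on_nonneg by blast
      fix s t :: real
      have "dist (y + s *\<^sub>R axis j 1) (y + t *\<^sub>R axis j 1) = dist s t"
        by (simp add: dist_norm flip: scaleR_left_diff_distrib)
      then show "dist ((partial j ^^ m) f (y + s *\<^sub>R axis j 1)) ((partial j ^^ m) f (y + t *\<^sub>R axis j 1)) \<le> L * dist s t"
        using lipschitz_onD[OF assms(2)] by (metis UNIV_I)
    qed
  qed
  then show ?thesis by simp
qed

text \<open>Expanding first in the second variable and then in the first one uses the iterated partials
  in exactly the order in which \<open>partials\<close> applies them, so no symmetry of mixed derivatives is
  needed.\<close>

lemma taylor_partials:
  fixes f :: "real ^ 2 \<Rightarrow> real"
  assumes C: "of_class_C m f" and L: "\<And>b\<^sub>1 b\<^sub>2. b\<^sub>1 + b\<^sub>2 = m \<Longrightarrow> L-lipschitz_on UNIV (partials b\<^sub>1 b\<^sub>2 f)"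
    and r: "\<bar>\<eta> $ 1\<bar> \<le> r" "\<bar>\<eta> $ 2\<bar> \<le> r"
  shows "\<bar>f (y + \<eta>) - (\<Sum>b\<^sub>2\<le>m. \<Sum>b\<^sub>1\<le>m - b\<^sub>2. partials b\<^sub>1 b\<^sub>2 f y / (fact b\<^sub>1 * fact b\<^sub>2) * (\<eta> $ 1) ^ b\<^sub>1 * (\<eta> $ 2) ^ b\<^sub>2)\<bar>
    \<le> real (m + 2) * L * r ^ Suc m"
proof -
  let ?y1 = "y + \<eta> $ 1 *\<^sub>R axis 1 1"
  have L0: "L \<ge> 0" using L[of m 0] lipschitz_on_nonneg by auto
  have r0: "r \<ge> 0" using r(1) by linarith
  have ye: "y + \<eta> = ?y1 + \<eta> $ 2 *\<^sub>R axis 2 1"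
    by (auto simp: vec_eq_iff forall_2 axis_def)
  have 1: "\<bar>f (?y1 + \<eta> $ 2 *\<^sub>R axis 2 1) - (\<Sum>b\<le>m. (partial 2 ^^ b) f ?y1 / fact b * (\<eta> $ 2) ^ b)\<bar> \<le> L * r ^ Suc m"
  proof -
    have "L * \<bar>\<eta> $ 2\<bar> ^ Suc m \<le> L * r ^ Suc m" by (intro mult_left_mono power_mono r L0) auto
    then show ?thesis
      using taylor_partial[OF C, of L 2 ?y1 "\<eta> $ 2"] L[of 0 m] by (simp add: partials_def)
  qed
  \<comment> \<open>Only \<open>m - b\<^sub>2\<close> orders remain for the first variable; the
    factor \<open>(\<eta> $ 2) ^ b\<^sub>2\<close> supplies the missing powers of
    \<open>r\<close>.\<close>
  have 2: "\<bar>(partial 2 ^^ b\<^sub>2) f ?y1 / fact b\<^sub>2 * (\<eta> $ 2) ^ b\<^sub>2 - 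
    (\<Sum>b\<^sub>1\<le>m - b\<^sub>2. partials b\<^sub>1 b\<^sub>2 f y / (fact b\<^sub>1 * fact b\<^sub>2) * (\<eta> $ 1) ^ b\<^sub>1 * (\<eta> $ 2) ^ b\<^sub>2)\<bar> \<le> L * r ^ Suc m"
    if b: "b\<^sub>2 \<le> m" for b\<^sub>2
  proof -
    have "of_class_C (m - b\<^sub>2) ((partial 2 ^^ b\<^sub>2) f)"
      using b C by (intro of_class_C_partial_pow) simp
    moreover have "L-lipschitz_on UNIV ((partial 1 ^^ (m - b\<^sub>2)) ((partial 2 ^^ b\<^sub>2) f))"
      using L[of "m - b\<^sub>2" b\<^sub>2] b by (simp add: partials_def)
    ultimately have "\<bar>(partial 2 ^^ b\<^sub>2) f ?y1 - (\<Sum>b\<^sub>1\<le>m - b\<^sub>2. partials b\<^sub>1 b\<^sub>2 f y / fact b\<^sub>1 * (\<eta> $ 1) ^ b\<^sub>1)\<bar> 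
        \<le> L * \<bar>\<eta> $ 1\<bar> ^ Suc (m - b\<^sub>2)" (is "\<bar>?d\<bar> \<le> _")
      unfolding partials_def by (rule taylor_partial)
    also have "\<dots> \<le> L * r ^ Suc (m - b\<^sub>2)" by (intro mult_left_mono power_mono r L0) auto
    finally have d: "\<bar>?d\<bar> \<le> L * r ^ Suc (m - b\<^sub>2)" .
    have "(partial 2 ^^ b\<^sub>2) f ?y1 / fact b\<^sub>2 * (\<eta> $ 2) ^ b\<^sub>2 - 
      (\<Sum>b\<^sub>1\<le>m - b\<^sub>2. partials b\<^sub>1 b\<^sub>2 f y / (fact b\<^sub>1 * fact b\<^sub>2) * (\<eta> $ 1) ^ b\<^sub>1 * (\<eta> $ 2) ^ b\<^sub>2) = ?d * ((\<eta> $ 2) ^ b\<^sub>2 / fact b\<^sub>2)"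
      unfolding left_diff_distrib sum_distrib_right by (intro arg_cong2[where f = minus] sum.cong) (simp_all add: mult_ac)
    also have "\<bar>\<dots>\<bar> \<le> (L * r ^ Suc (m - b\<^sub>2)) * r ^ b\<^sub>2"
      unfolding abs_mult
    proof (intro mult_mono d)
      have "\<bar>(\<eta> $ 2) ^ b\<^sub>2 / fact b\<^sub>2\<bar> \<le> \<bar>\<eta> $ 2\<bar> ^ b\<^sub>2"
        using fact_ge_1[of b\<^sub>2, where ?'a = real] by (simp add: power_abs divide_le_eq mult_le_cancel_left1)
      also have "\<dots> \<le> r ^ b\<^sub>2" using r by (intro power_mono) auto
      finally show "\<bar>(\<eta> $ 2) ^ b\<^sub>2 / fact b\<^sub>2\<bar> \<le> r ^ b\<^sub>2" .
    qed (use L0 r0 in auto)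
    also have "\<dots> = L * r ^ Suc m" using b by (simp flip: power_add)
    finally show ?thesis .
  qed
  have "\<bar>(\<Sum>b\<^sub>2\<le>m. (partial 2 ^^ b\<^sub>2) f ?y1 / fact b\<^sub>2 * (\<eta> $ 2) ^ b\<^sub>2) - 
    (\<Sum>b\<^sub>2\<le>m. \<Sum>b\<^sub>1\<le>m - b\<^sub>2. partials b\<^sub>1 b\<^sub>2 f y / (fact b\<^sub>1 * fact b\<^sub>2) * (\<eta> $ 1) ^ b\<^sub>1 * (\<eta> $ 2) ^ b\<^sub>2)\<bar> \<le> (\<Sum>b\<^sub>2\<le>m. L * r ^ Suc m)"
    unfolding sum_subtractf[symmetric] by (rule order_trans[OF sum_abs sum_mono]) (use 2 in auto)
  then show ?thesis using 1 unfolding ye by (simp add: algebra_simps) 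
qed

section \<open>Exact solutions in a strong magnetic field\<close>

lemma J_vec: "(J *v z) $ 1 = z $ 2" "(J *v z) $ 2 = - z $ 1"
  by (simp_all add: J_def matrix_vector_mult_def sum_2)

lemma J_inner: "z \<bullet> (J *v z) = 0"
  by (simp add: inner_vec_def sum_2 J_vec)

lemma J_J: "J *v (J *v z) = - z"
  by (simp add: vec_eq_iff forall_2 J_vec)

lemma norm_J: "norm (J *v z) = norm z"
  by (simp add: norm_vec_def L2_set_def sum_2 J_vec add.commute)

lemma lipschitz_derivatives_lipschitz:
  assumes "lipschitz_derivatives k E"
  obtains L where "L \<ge> 0" "\<And>x y. norm (E x - E y) \<le> L * norm (x - y)"
proof -
  have "\<exists>L. L-lipschitz_on UNIV (\<lambda>y. E y $ i)" for i
  proof -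
    have "\<exists>L. L-lipschitz_on UNIV (partials 0 0 (\<lambda>y. E y $ i))"
      using assms unfolding lipschitz_derivatives_def by (metis add_0 le0)
    then show ?thesis by (simp add: partials_def)
  qed
  then obtain L1 L2 where L: "L1-lipschitz_on UNIV (\<lambda>y. E y $ 1)" "L2-lipschitz_on UNIV (\<lambda>y. E y $ 2)"
    by metis
  show ?thesis
  proof (rule that)
    show "L1 + L2 \<ge> 0" using L[THEN lipschitz_on_nonneg] by simp
    fix x y
    have "norm (E x - E y) \<le> (\<Sum>i\<in>UNIV. \<bar>(E x - E y) $ i\<bar>)" by (rule norm_le_l1_cart)
    also have "\<dots> \<le> L1 * norm (x - y) + L2 * norm (x - y)"
      using L[THEN lipschitz_onD, of x y] by (simp add: sum_2 dist_norm dist_real_def)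
    finally show "norm (E x - E y) \<le> (L1 + L2) * norm (x - y)" by (simp add: distrib_right)
  qed
qed

lemma vector_differentiable_bound:
  fixes f :: "real \<Rightarrow> 'a::real_normed_vector"
  assumes "\<And>x. x \<in> S \<Longrightarrow> (f has_vector_derivative f' x) (at x within S)"
    and "\<And>x. x \<in> S \<Longrightarrow> norm (f' x) \<le> B" and "convex S" "x \<in> S" "y \<in> S"
  shows "norm (f x - f y) \<le> B * norm (x - y)"
proof (rule differentiable_bound[OF assms(3) _ _ assms(4,5)])
  fix t assume t: "t \<in> S"
  show "(f has_derivative (\<lambda>h. h *\<^sub>R f' t)) (at t within S)"
    using assms(1)[OF t] by (simp add: has_vector_derivative_def)
  show "onorm (\<lambda>h. h *\<^sub>R f' t) \<le> B"
    using assms(2)[OF t] by (intro onorm_le) (simp add: mult.commute[of B] mult_left_mono)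
qed

text \<open>The magnetic force is orthogonal to the velocity, so an energy estimate bounds the
  solution uniformly in \<open>\<epsilon>\<close>. Displacements are of order
  \<open>\<bar>t - s\<bar>\<close> by integrating the equations. The position also moves by only
  \<open>O(\<epsilon>)\<close>, because the guiding centre drifts slowly and the gyration has radius
  \<open>O(\<epsilon>)\<close>.\<close>

lemma cpd_solution_bounds:
  assumes lip: "lipschitz_derivatives k E" and T: "T > 0"
  obtains K where "K \<ge> 1"
    "\<And>\<epsilon> y z s t. \<lbrakk>0 < \<epsilon>; \<epsilon> \<le> 1; cpd_solution E \<epsilon> T y\<^sub>0 z\<^sub>0 y z; s \<in> {0..T}; t \<in> {0..T}\<rbrakk>
      \<Longrightarrow> norm (y t) \<le> K \<and> norm (z t) \<le> K 
        \<and> norm (y t - y s) \<le> K * min \<epsilon> \<bar>t - s\<bar> \<and> \<epsilon> * norm (z t - z s) \<le> K * min \<epsilon> \<bar>t - s\<bar>"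
proof -
  obtain L where L: "L \<ge> 0" "\<And>x y. norm (E x - E y) \<le> L * norm (x - y)"
    using lipschitz_derivatives_lipschitz[OF lip] by blast
  define e0 where "e0 = norm (E y\<^sub>0)"
  define \<kappa> where "\<kappa> = L + 2"
  \<comment> \<open>The summand 1 gives \<open>B \<le> B\<^sup>2\<close>, so a bound
    \<open>B\<close> on the squared norms also bounds the norms.\<close>
  define B where "B = 1 + exp (\<kappa> * T) * ((norm z\<^sub>0)\<^sup>2 + e0\<^sup>2)"
  define F where "F = e0 + L * B"
  define K where "K = norm y\<^sub>0 + 3 * B + F + T * F"
  have B: "B \<ge> 1" by (simp add: B_def)
  have F: "F \<ge> 0" using L B by (simp add: F_def e0_def)
  have K: "K \<ge> 1" "K \<ge> norm y\<^sub>0 + B" "K \<ge> B" "K \<ge> 2 * B" "K \<ge> B + F" "K \<ge> 2 * B + T * F"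
    using B F mult_nonneg_nonneg[OF less_imp_le[OF T] F] norm_ge_zero[of y\<^sub>0] unfolding K_def by linarith+
  show ?thesis
  proof (rule that[OF K(1)])
    fix \<epsilon> s t :: real and y z :: "real \<Rightarrow> real ^ 2"
    assume \<epsilon>: "0 < \<epsilon>" "\<epsilon> \<le> 1" and sol: "cpd_solution E \<epsilon> T y\<^sub>0 z\<^sub>0 y z" 
      and s: "s \<in> {0..T}" and t: "t \<in> {0..T}"
    let ?z' = "\<lambda>t. (1 / \<epsilon>) *\<^sub>R (J *v z t) + E (y t)"
    have dy: "(y has_vector_derivative z t) (at t within {0..T})" if "t \<in> {0..T}" for t
      using sol that unfolding cpd_solution_def by blast
    have dz: "(z has_vector_derivative ?z' t) (at t within {0..T})" if "t \<in> {0..T}" for t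
      using sol that unfolding cpd_solution_def by blast
    have init: "y 0 = y\<^sub>0" "z 0 = z\<^sub>0" using sol unfolding cpd_solution_def by auto
    have Ey: "norm (E (y t)) \<le> e0 + L * norm (y t - y\<^sub>0)" for t
      using L(2)[of "y t" y\<^sub>0] norm_triangle_ineq2[of "E (y t)" "E y\<^sub>0"] by (simp add: e0_def)
    define S where "S = (\<lambda>t. (norm (z t))\<^sup>2 + (norm (y t - y\<^sub>0))\<^sup>2)"
    have Sb: "S t \<le> B" if t: "t \<in> {0..T}" for t
    proof -
      have "S t + e0\<^sup>2 \<le> exp (\<kappa> * (t - 0)) * (S 0 + e0\<^sup>2)"
      proof (rule gronwall_quadratic)
        show "0 \<le> t" "\<kappa> > 0" using t L by (auto simp: \<kappa>_def)
        fix r assume "r \<in> {0..t}"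
        then have r: "r \<in> {0..T}" using t by auto
        have dq: "((\<lambda>t. z t \<bullet> z t) has_derivative (\<lambda>h. z r \<bullet> (h *\<^sub>R ?z' r) + (h *\<^sub>R ?z' r) \<bullet> z r)) (at r within {0..T})"
          "((\<lambda>t. (y t - y\<^sub>0) \<bullet> (y t - y\<^sub>0)) has_derivative (\<lambda>h. (y r - y\<^sub>0) \<bullet> (h *\<^sub>R z r) + (h *\<^sub>R z r) \<bullet> (y r - y\<^sub>0))) (at r within {0..T})"
          using dz[OF r] dy[OF r] unfolding has_vector_derivative_def
          by (auto intro!: has_derivative_inner derivative_eq_intros)
        have "(S has_vector_derivative (2 * (z r \<bullet> ?z' r) + 2 * ((y r - y\<^sub>0) \<bullet> z r))) (at r within {0..T})"
          unfolding S_def power2_norm_eq_inner has_vector_derivative_def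
          by (rule has_derivative_eq_rhs[OF has_derivative_add[OF dq]]) 
            (auto simp: fun_eq_iff algebra_simps inner_commute)
        then show "(S has_vector_derivative (2 * (z r \<bullet> ?z' r) + 2 * ((y r - y\<^sub>0) \<bullet> z r))) (at r within {0..t})"
          using t by (rule_tac has_vector_derivative_within_subset) auto
        have "z r \<bullet> ?z' r = z r \<bullet> E (y r)" by (simp add: inner_right_distrib J_inner)
        also have "\<dots> \<le> norm (z r) * norm (E (y r))" by (rule norm_cauchy_schwarz)
        also have "\<dots> \<le> norm (z r) * (e0 + L * norm (y r - y\<^sub>0))" by (intro mult_left_mono Ey) auto
        finally have 1: "2 * (z r \<bullet> ?z' r) \<le> 2 * norm (z r) * e0 + L * (2 * norm (z r) * norm (y r - y\<^sub>0))"
          by (simp add: algebra_simps)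
        also have "\<dots> \<le> ((norm (z r))\<^sup>2 + e0\<^sup>2) + L * S r"
          unfolding S_def by (intro add_mono sum_squares_bound mult_left_mono L)
        finally have 1: "2 * (z r \<bullet> ?z' r) \<le> S r + e0\<^sup>2 + L * S r" 
          unfolding S_def using zero_le_power2[of "norm (y r - y\<^sub>0)"] by linarith
        have "2 * ((y r - y\<^sub>0) \<bullet> z r) \<le> 2 * norm (z r) * norm (y r - y\<^sub>0)"
          using norm_cauchy_schwarz[of "y r - y\<^sub>0" "z r"] by (simp add: mult_ac)
        also have "\<dots> \<le> S r" unfolding S_def by (rule sum_squares_bound)
        finally have "2 * (z r \<bullet> ?z' r) + 2 * ((y r - y\<^sub>0) \<bullet> z r) \<le> \<kappa> * S r + e0\<^sup>2" 
          using 1 by (simp add: \<kappa>_def algebra_simps)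
        also have "\<dots> \<le> \<kappa> * S r + \<kappa> * e0\<^sup>2"
          using L by (simp add: \<kappa>_def mult_le_cancel_right1)
        finally show "2 * (z r \<bullet> ?z' r) + 2 * ((y r - y\<^sub>0) \<bullet> z r) \<le> \<kappa> * (S r + e0\<^sup>2)"
          by (simp add: distrib_left)
      qed
      also have "\<dots> \<le> exp (\<kappa> * T) * ((norm z\<^sub>0)\<^sup>2 + e0\<^sup>2)"
        using t L by (auto simp: S_def init \<kappa>_def intro!: mult_right_mono)
      finally show ?thesis unfolding B_def using zero_le_power2[of e0] by linarith
    qed
    have zB: "norm (z t) \<le> B" and yB: "norm (y t - y\<^sub>0) \<le> B" if t: "t \<in> {0..T}" for t
    proof -
      have "(norm (z t))\<^sup>2 \<le> B" "(norm (y t - y\<^sub>0))\<^sup>2 \<le> B"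
        using Sb[OF t] zero_le_power2[of "norm (z t)"] zero_le_power2[of "norm (y t - y\<^sub>0)"]
        unfolding S_def by linarith+
      moreover have "B \<le> B\<^sup>2" using self_le_power[OF B, of 2] by simp
      ultimately have "(norm (z t))\<^sup>2 \<le> B\<^sup>2" "(norm (y t - y\<^sub>0))\<^sup>2 \<le> B\<^sup>2"
        by linarith+
      then show "norm (z t) \<le> B" "norm (y t - y\<^sub>0) \<le> B"
        using B by (auto elim!: power2_le_imp_le)
    qed
    have EF: "norm (E (y t)) \<le> F" if t: "t \<in> {0..T}" for t
      using Ey[of t] mult_left_mono[OF yB[OF t] L(1)] by (simp add: F_def)
    have ys: "norm (y t - y s) \<le> K * \<bar>t - s\<bar>"
    proof -
      have "norm (y t - y s) \<le> B * norm (t - s)"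
        using dy zB by (intro vector_differentiable_bound[where f' = z and S = "{0..T}"] s t) auto
      also have "\<dots> \<le> K * \<bar>t - s\<bar>" using K by (simp add: mult_right_mono)
      finally show ?thesis .
    qed
    have zs: "\<epsilon> * norm (z t - z s) \<le> K * \<bar>t - s\<bar>"
    proof -
      have "norm (z t - z s) \<le> (B / \<epsilon> + F) * norm (t - s)"
      proof (intro vector_differentiable_bound[where f' = ?z' and S = "{0..T}"] s t dz)
        fix r assume r: "r \<in> {0..T}"
        have "norm (?z' r) \<le> norm ((1 / \<epsilon>) *\<^sub>R (J *v z r)) + norm (E (y r))" by (rule norm_triangle_ineq)
        also have "\<dots> \<le> B / \<epsilon> + F"
          using zB[OF r] EF[OF r] \<epsilon> by (intro add_mono) (auto simp: norm_J divide_right_mono)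
        finally show "norm (?z' r) \<le> B / \<epsilon> + F" .
      qed auto
      then have "\<epsilon> * norm (z t - z s) \<le> \<epsilon> * ((B / \<epsilon> + F) * \<bar>t - s\<bar>)"
        using \<epsilon> by (intro mult_left_mono) auto
      also have "\<dots> = (B + \<epsilon> * F) * \<bar>t - s\<bar>" using \<epsilon> by (simp add: field_simps)
      also have "\<dots> \<le> K * \<bar>t - s\<bar>"
        using K(5) mult_right_mono[OF \<epsilon>(2) F] by (intro mult_right_mono) auto
      finally show ?thesis .
    qed
    have z\<epsilon>: "norm (z t - z s) \<le> 2 * B"
      using zB[OF s] zB[OF t] norm_triangle_ineq4[of "z t" "z s"] by linarith
    have y\<epsilon>: "norm (y t - y s) \<le> K * \<epsilon>"
    proof -
      \<comment> \<open>The guiding centre: applying \<open>J\<close> twice changes the sign, so the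
        velocity cancels and a derivative of size \<open>\<epsilon>\<close> remains.\<close>
      let ?c = "\<lambda>t. y t + \<epsilon> *\<^sub>R (J *v z t)"
      have dc: "(?c has_vector_derivative \<epsilon> *\<^sub>R (J *v E (y r))) (at r within {0..T})" if r: "r \<in> {0..T}" for r
      proof -
        have "(?c has_vector_derivative z r + \<epsilon> *\<^sub>R (J *v ?z' r)) (at r within {0..T})"
          by (intro has_vector_derivative_add dy r
              bounded_linear.has_vector_derivative[OF bounded_linear_scaleR_right]
              bounded_linear.has_vector_derivative[OF matrix_vector_mul_bounded_linear] dz)
        also have "z r + \<epsilon> *\<^sub>R (J *v ?z' r) = \<epsilon> *\<^sub>R (J *v E (y r))"
          using \<epsilon> by (simp add: matrix_vector_right_distrib matrix_vector_mult_scaleR J_J algebra_simps)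
        finally show ?thesis .
      qed
      have "norm (?c t - ?c s) \<le> (\<epsilon> * F) * norm (t - s)"
        using dc EF \<epsilon> by (intro vector_differentiable_bound[where f' = "\<lambda>r. \<epsilon> *\<^sub>R (J *v E (y r))" and S = "{0..T}"] s t)
          (auto simp: norm_J)
      also have "\<dots> \<le> (\<epsilon> * F) * T" using s t \<epsilon> F by (intro mult_left_mono) auto
      finally have c: "norm (?c t - ?c s) \<le> \<epsilon> * (T * F)" by (simp add: mult_ac)
      have e: "y t - y s = (?c t - ?c s) - \<epsilon> *\<^sub>R (J *v (z t - z s))"
        by (simp add: matrix_vector_mult_diff_distrib algebra_simps)
      have "norm (y t - y s) \<le> norm (?c t - ?c s) + norm (\<epsilon> *\<^sub>R (J *v (z t - z s)))"
        unfolding e by (rule norm_triangle_ineq4)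
      also have "norm (\<epsilon> *\<^sub>R (J *v (z t - z s))) = \<epsilon> * norm (z t - z s)"
        using \<epsilon> by (simp add: norm_J)
      also have "norm (?c t - ?c s) + \<epsilon> * norm (z t - z s) \<le> \<epsilon> * (T * F) + \<epsilon> * (2 * B)"
        using c z\<epsilon> \<epsilon> by (intro add_mono mult_left_mono) auto
      also have "\<dots> = \<epsilon> * (2 * B + T * F)" by (simp add: distrib_left)
      also have "\<dots> \<le> \<epsilon> * K" using K(6) \<epsilon> by (intro mult_left_mono) auto
      finally show ?thesis by (simp add: mult.commute)
    qed
    have "\<epsilon> * norm (z t - z s) \<le> K * \<epsilon>"
      using mult_left_mono[OF order_trans[OF z\<epsilon> K(4)], of \<epsilon>] \<epsilon> by (simp add: mult.commute)
    moreover have "norm (y t) \<le> K"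
      using yB[OF t] K(2) norm_triangle_ineq2[of "y t" y\<^sub>0] by linarith
    moreover have "norm (z t) \<le> K" using zB[OF t] K(3) by linarith
    ultimately show "norm (y t) \<le> K \<and> norm (z t) \<le> K 
        \<and> norm (y t - y s) \<le> K * min \<epsilon> \<bar>t - s\<bar> \<and> \<epsilon> * norm (z t - z s) \<le> K * min \<epsilon> \<bar>t - s\<bar>"
      using ys zs y\<epsilon> by (simp add: min_def)
  qed
qed

section \<open>Monomials and the slow part\<close>

definition mpow :: "real ^ 4 \<Rightarrow> mindex \<Rightarrow> real" where
  "mpow \<xi> \<alpha> = \<xi> $ 1 ^ \<alpha> $ 1 * \<xi> $ 2 ^ \<alpha> $ 2 * \<xi> $ 3 ^ \<alpha> $ 3 * \<xi> $ 4 ^ \<alpha> $ 4"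

lemma mpow_0 [simp]: "mpow \<xi> 0 = 1"
  by (simp add: mpow_def)

lemma mpow_add: "mpow \<xi> (\<alpha> + \<beta>) = mpow \<xi> \<alpha> * mpow \<xi> \<beta>"
  by (simp add: mpow_def power_add)

lemma mpow_munit [simp]: "mpow \<xi> (munit i) = \<xi> $ i"
  using exhaust_4[of i] by (auto simp: mpow_def axis_def)

lemma mpow_abs_le:
  assumes "\<And>i. \<bar>\<xi> $ i\<bar> \<le> r"
  shows "\<bar>mpow \<xi> \<alpha>\<bar> \<le> r ^ mlen \<alpha>"
proof -
  have "r \<ge> 0" using assms[of 1] by linarith
  then show ?thesis
    unfolding mpow_def mlen_def power_add abs_mult power_abs
    by (intro mult_mono power_mono assms) auto
qed

lemma munit_diff_add:
  fixes \<alpha> :: mindex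
  assumes "\<alpha> $ i > 0"
  shows "\<alpha> - munit i + munit i = \<alpha>" "\<alpha> + \<beta> - munit i = (\<alpha> - munit i) + \<beta>" 
    "mlen (\<alpha> - munit i) = mlen \<alpha> - 1" "mlen \<alpha> \<ge> 1"
proof -
  show 1: "\<alpha> - munit i + munit i = \<alpha>" using assms by (auto simp: vec_eq_iff axis_def)
  show "\<alpha> + \<beta> - munit i = (\<alpha> - munit i) + \<beta>" using assms by (auto simp: vec_eq_iff axis_def)
  have "mlen \<alpha> = mlen (\<alpha> - munit i) + 1"
    using mlen_add[of "\<alpha> - munit i" "munit i"] unfolding 1 by simp
  then show "mlen (\<alpha> - munit i) = mlen \<alpha> - 1" "mlen \<alpha> \<ge> 1" by auto
qed

lemma mlen_diff_le: "mlen (\<alpha> - \<beta>) \<le> mlen \<alpha>"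
  by (simp add: mlen_def add_mono)

lemma nth_le_mlen: "\<alpha> $ i \<le> mlen \<alpha>"
  using exhaust_4[of i] by (auto simp: mlen_def)

lemma mpow_has_derivative:
  assumes "\<And>i. ((\<lambda>t. \<xi> t $ i) has_real_derivative d i) (at t within A)"
  shows "((\<lambda>t. mpow (\<xi> t) \<alpha>) has_real_derivative 
    (\<Sum>i\<in>UNIV. real (\<alpha> $ i) * d i * mpow (\<xi> t) (\<alpha> - munit i))) (at t within A)"
  unfolding mpow_def
  by (rule derivative_eq_intros assms refl)+ (simp add: sum_4 axis_def algebra_simps flip: One_nat_def)

text \<open>\<open>A0_action\<close> with the derivatives of the field replaced by an arbitrary
  family \<open>P\<close>. It is bilinear in \<open>P\<close> and \<open>v\<close>, so a change of
  the point of freezing can be separated from a change of the vector.\<close>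

definition A0_sum :: "nat \<Rightarrow> (2 \<Rightarrow> nat \<Rightarrow> nat \<Rightarrow> real) \<Rightarrow> (mindex \<Rightarrow> real) \<Rightarrow> mindex \<Rightarrow> real" where
  "A0_sum k P v \<alpha> = (\<Sum>\<beta> | \<beta> $ 3 = 0 \<and> \<beta> $ 4 = 0 \<and> mlen \<beta> \<le> k - mlen \<alpha> + 1.
        1 / (fact (\<beta> $ 1) * fact (\<beta> $ 2)) *
        (real (\<alpha> $ 3) * P 1 (\<beta> $ 1) (\<beta> $ 2) * v (\<alpha> + \<beta> - munit 3)
         + real (\<alpha> $ 4) * P 2 (\<beta> $ 1) (\<beta> $ 2) * v (\<alpha> + \<beta> - munit 4)))"

definition jet :: "(real ^ 2 \<Rightarrow> real ^ 2) \<Rightarrow> real ^ 2 \<Rightarrow> 2 \<Rightarrow> nat \<Rightarrow> nat \<Rightarrow> real" where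
  "jet E y i b\<^sub>1 b\<^sub>2 = partials b\<^sub>1 b\<^sub>2 (\<lambda>y. E y $ i) y"

lemma A0_action_eq: "A0_action k E x v \<alpha> = A0_sum k (jet E (position_part x)) v \<alpha>"
  by (simp add: A0_action_def A0_sum_def jet_def)

lemma A0_sum_0: "A0_sum k P v 0 = 0"
  by (simp add: A0_sum_def)

lemma A0_sum_diff:
  "A0_sum k P v \<alpha> - A0_sum k P w \<alpha> = A0_sum k P (\<lambda>\<alpha>. v \<alpha> - w \<alpha>) \<alpha>"
  "A0_sum k P v \<alpha> - A0_sum k Q v \<alpha> = A0_sum k (\<lambda>i b\<^sub>1 b\<^sub>2. P i b\<^sub>1 b\<^sub>2 - Q i b\<^sub>1 b\<^sub>2) v \<alpha>"
  unfolding A0_sum_def sum_subtractf[symmetric] by (rule sum.cong; simp add: algebra_simps diff_divide_distrib add_divide_distrib)+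

text \<open>A nonzero \<open>\<alpha> $ j\<close> forces \<open>mlen \<alpha> \<ge> 1\<close>, and
  then only derivatives of order at most \<open>k\<close> and components of length at most
  \<open>k\<close> enter. The count uses \<open>mindices (k + 1)\<close> because for
  \<open>\<alpha> = 0\<close> the range of \<open>\<beta>\<close> reaches length
  \<open>k + 1\<close>.\<close>

lemma A0_sum_abs_le:
  assumes \<alpha>: "mlen \<alpha> \<le> k" and P: "\<And>i b\<^sub>1 b\<^sub>2. b\<^sub>1 + b\<^sub>2 \<le> k \<Longrightarrow> \<bar>P i b\<^sub>1 b\<^sub>2\<bar> \<le> p"
    and v: "\<And>\<alpha>. mlen \<alpha> \<le> k \<Longrightarrow> \<bar>v \<alpha>\<bar> \<le> U"
  shows "\<bar>A0_sum k P v \<alpha>\<bar> \<le> real (card (mindices (k + 1))) * (2 * k) * p * U"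
proof -
  let ?B = "{\<beta>::mindex. \<beta> $ 3 = 0 \<and> \<beta> $ 4 = 0 \<and> mlen \<beta> \<le> k - mlen \<alpha> + 1}"
  have p: "p \<ge> 0" using P[of 0 0 1] abs_ge_zero[of "P 1 0 0"] by linarith
  have U: "U \<ge> 0" using v[of \<alpha>] \<alpha> abs_ge_zero[of "v \<alpha>"] by linarith
  have t: "\<bar>real (\<alpha> $ j) * P i (\<beta> $ 1) (\<beta> $ 2) * v (\<alpha> + \<beta> - munit j)\<bar> \<le> k * p * U" 
    if \<beta>: "\<beta> \<in> ?B" for \<beta> i j
  proof (cases "\<alpha> $ j = 0")
    case False
    then have m: "\<alpha> + \<beta> - munit j = (\<alpha> - munit j) + \<beta>" "mlen (\<alpha> - munit j) = mlen \<alpha> - 1" "mlen \<alpha> \<ge> 1"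
      using munit_diff_add by auto
    have "\<beta> $ 1 + \<beta> $ 2 \<le> k" using \<beta> m(3) \<alpha> by (auto simp: mlen_def)
    moreover have "mlen (\<alpha> + \<beta> - munit j) \<le> k" 
      unfolding m(1) mlen_add m(2) using \<beta> m(3) \<alpha> by auto
    moreover have "\<alpha> $ j \<le> k" using nth_le_mlen[of \<alpha> j] \<alpha> by linarith
    ultimately show ?thesis
      unfolding abs_mult using p U by (intro mult_mono P v) auto
  qed (use p U in simp)
  have "\<bar>A0_sum k P v \<alpha>\<bar> \<le> (\<Sum>\<beta>\<in>?B. (2 * k) * p * U)"
    unfolding A0_sum_def
  proof (rule order_trans[OF sum_abs sum_mono])
    fix \<beta> assume \<beta>: "\<beta> \<in> ?B"
    let ?s = "real (\<alpha> $ 3) * P 1 (\<beta> $ 1) (\<beta> $ 2) * v (\<alpha> + \<beta> - munit 3)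
         + real (\<alpha> $ 4) * P 2 (\<beta> $ 1) (\<beta> $ 2) * v (\<alpha> + \<beta> - munit 4)"
    have "1 / (fact (\<beta> $ 1) * fact (\<beta> $ 2)) \<le> (1::real)"
      using mult_mono[OF fact_ge_1[of "\<beta> $ 1", where ?'a = real] fact_ge_1[of "\<beta> $ 2", where ?'a = real]] by simp
    then have "\<bar>1 / (fact (\<beta> $ 1) * fact (\<beta> $ 2)) * ?s\<bar> \<le> 1 * \<bar>?s\<bar>"
      unfolding abs_mult by (intro mult_right_mono) auto
    also have "\<dots> \<le> (2 * k) * p * U"
      using t[OF \<beta>, of 3 1] t[OF \<beta>, of 4 2] by (simp add: mult.assoc)
    finally show "\<bar>1 / (fact (\<beta> $ 1) * fact (\<beta> $ 2)) * ?s\<bar> \<le> (2 * k) * p * U" .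
  qed
  also have "\<dots> = real (card ?B) * ((2 * k) * p * U)" by simp
  also have "\<dots> \<le> real (card (mindices (k + 1))) * ((2 * k) * p * U)"
    using p U \<alpha> by (intro mult_right_mono of_nat_mono card_mono finite_mindices) (auto simp: mindices_def)
  finally show ?thesis by (simp add: mult_ac)
qed

lemma lower_abs_le:
  assumes \<alpha>: "mlen \<alpha> \<le> k" and v: "\<And>\<alpha>. mlen \<alpha> \<le> k \<Longrightarrow> \<bar>v \<alpha>\<bar> \<le> U"
    and x: "\<bar>x $ 3\<bar> \<le> g" "\<bar>x $ 4\<bar> \<le> g"
  shows "\<bar>lower x v \<alpha>\<bar> \<le> 4 * k * g * U"
proof -
  have U: "U \<ge> 0" using v[of \<alpha>] \<alpha> abs_ge_zero[of "v \<alpha>"] by linarith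
  have "\<bar>real (\<alpha> $ j) * x $ i * v (\<alpha> - munit j)\<bar> \<le> k * g * U" if "i = 3 \<or> i = 4" for i j
    unfolding abs_mult
  proof (intro mult_mono)
    show "\<bar>v (\<alpha> - munit j)\<bar> \<le> U" using v mlen_diff_le[of \<alpha> "munit j"] \<alpha> by simp
    show "\<bar>real (\<alpha> $ j)\<bar> \<le> real k" using nth_le_mlen[of \<alpha> j] \<alpha> by simp
  qed (use that x U in auto)
  from this[of 3 1] this[of 4 2] this[of 4 3] this[of 3 4] show ?thesis
    unfolding lower_def by simp
qed

lemma of_class_C_mono:
  assumes "of_class_C k f" "m \<le> k"
  shows "of_class_C m f"
proof -
  have "of_class_C n f" if "of_class_C (Suc n) f" for n f
    using that
  proof (induction n arbitrary: f)
    case 0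
    then show ?case
      by (auto simp: continuous_on_eq_continuous_within intro: differentiable_imp_continuous_within)
  next
    case (Suc n)
    then show ?case by (metis of_class_C.simps(2))
  qed
  with assms(2,1) show ?thesis by (induction rule: inc_induct) auto
qed

lemma sum_planar_mindices:
  fixes g :: "mindex \<Rightarrow> real"
  shows "(\<Sum>\<beta> | \<beta> $ 3 = 0 \<and> \<beta> $ 4 = 0 \<and> mlen \<beta> \<le> m. g \<beta>) = 
    (\<Sum>b\<^sub>2\<le>m. \<Sum>b\<^sub>1\<le>m - b\<^sub>2. g (vector [b\<^sub>1, b\<^sub>2, 0, 0]))"
proof -
  have "(\<Sum>b\<^sub>2\<le>m. \<Sum>b\<^sub>1\<le>m - b\<^sub>2. g (vector [b\<^sub>1, b\<^sub>2, 0, 0])) = 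
    (\<Sum>(b\<^sub>2, b\<^sub>1)\<in>(SIGMA b\<^sub>2:{..m}. {..m - b\<^sub>2}). g (vector [b\<^sub>1, b\<^sub>2, 0, 0]))"
    by (rule sum.Sigma) auto
  also have "\<dots> = (\<Sum>\<beta> | \<beta> $ 3 = 0 \<and> \<beta> $ 4 = 0 \<and> mlen \<beta> \<le> m. g \<beta>)"
    by (rule sum.reindex_bij_witness[where i = "\<lambda>\<beta>. (\<beta> $ 2, \<beta> $ 1)" and j = "\<lambda>(b\<^sub>2, b\<^sub>1). vector [b\<^sub>1, b\<^sub>2, 0, 0]"])
      (auto simp: mlen_def vec_eq_iff forall_4)
  finally show ?thesis by simp
qed

text \<open>On monomials the shift by \<open>\<beta>\<close> is a product, so the sum factors into
  the derivative of the monomial times Taylor polynomials of degree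
  \<open>k - mlen \<alpha> + 1\<close>.\<close>

lemma A0_sum_mpow:
  "A0_sum k P (mpow \<xi>) \<alpha> = 
    real (\<alpha> $ 3) * mpow \<xi> (\<alpha> - munit 3) * (\<Sum>b\<^sub>2\<le>k - mlen \<alpha> + 1. \<Sum>b\<^sub>1\<le>k - mlen \<alpha> + 1 - b\<^sub>2. P 1 b\<^sub>1 b\<^sub>2 / (fact b\<^sub>1 * fact b\<^sub>2) * (\<xi> $ 1) ^ b\<^sub>1 * (\<xi> $ 2) ^ b\<^sub>2)
  + real (\<alpha> $ 4) * mpow \<xi> (\<alpha> - munit 4) * (\<Sum>b\<^sub>2\<le>k - mlen \<alpha> + 1. \<Sum>b\<^sub>1\<le>k - mlen \<alpha> + 1 - b\<^sub>2. P 2 b\<^sub>1 b\<^sub>2 / (fact b\<^sub>1 * fact b\<^sub>2) * (\<xi> $ 1) ^ b\<^sub>1 * (\<xi> $ 2) ^ b\<^sub>2)"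
proof -
  have *: "real (\<alpha> $ j) * mpow \<xi> (\<alpha> + \<beta> - munit j) = real (\<alpha> $ j) * mpow \<xi> (\<alpha> - munit j) * mpow \<xi> \<beta>" for j \<beta>
    by (cases "\<alpha> $ j = 0") (auto simp: munit_diff_add mpow_add)
  have s: "(\<Sum>b\<^sub>2\<le>m. \<Sum>b\<^sub>1\<le>m - b\<^sub>2. P i b\<^sub>1 b\<^sub>2 / (fact b\<^sub>1 * fact b\<^sub>2) * (\<xi> $ 1) ^ b\<^sub>1 * (\<xi> $ 2) ^ b\<^sub>2) =
    (\<Sum>\<beta> | \<beta> $ 3 = 0 \<and> \<beta> $ 4 = 0 \<and> mlen \<beta> \<le> m. P i (\<beta> $ 1) (\<beta> $ 2) / (fact (\<beta> $ 1) * fact (\<beta> $ 2)) * mpow \<xi> \<beta>)" for m i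
    unfolding sum_planar_mindices by (simp add: mpow_def mult.assoc)
  show ?thesis
    unfolding s A0_sum_def sum_distrib_left sum.distrib[symmetric]
  proof (rule sum.cong[OF refl], goal_cases)
    case (1 \<beta>)
    show ?case
      using *[of 3 \<beta>] *[of 4 \<beta>] by (auto simp: distrib_left mult_ac)
  qed
qed

text \<open>The differentiated monomial contributes \<open>r ^ (mlen \<alpha> - 1)\<close> and the
  Taylor remainder \<open>r ^ (k - mlen \<alpha> + 2)\<close>. The degree of truncation in the
  scheme balances them, so every component has the same order \<open>k + 1\<close>.\<close>

lemma A0_sum_remainder:
  fixes E :: "real ^ 2 \<Rightarrow> real ^ 2"
  assumes C: "\<And>i. of_class_C k (\<lambda>y. E y $ i)" 
    and L: "\<And>i b\<^sub>1 b\<^sub>2. b\<^sub>1 + b\<^sub>2 \<le> k \<Longrightarrow> L-lipschitz_on UNIV (partials b\<^sub>1 b\<^sub>2 (\<lambda>y. E y $ i))"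
    and \<alpha>: "mlen \<alpha> \<le> k" and r: "\<And>i. \<bar>\<xi> $ i\<bar> \<le> r"
  shows "\<bar>real (\<alpha> $ 3) * mpow \<xi> (\<alpha> - munit 3) * E (y + position_part \<xi>) $ 1
      + real (\<alpha> $ 4) * mpow \<xi> (\<alpha> - munit 4) * E (y + position_part \<xi>) $ 2
      - A0_sum k (jet E y) (mpow \<xi>) \<alpha>\<bar> \<le> 2 * real (k * (k + 2)) * L * r ^ (k + 1)"
proof -
  let ?m = "k - mlen \<alpha> + 1"
  let ?T = "\<lambda>i. \<Sum>b\<^sub>2\<le>?m. \<Sum>b\<^sub>1\<le>?m - b\<^sub>2. jet E y i b\<^sub>1 b\<^sub>2 / (fact b\<^sub>1 * fact b\<^sub>2) * (\<xi> $ 1) ^ b\<^sub>1 * (\<xi> $ 2) ^ b\<^sub>2"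
  have r0: "r \<ge> 0" using r[of 1] by linarith
  have L0: "L \<ge> 0" using L[of 0 0] lipschitz_on_nonneg by auto
  have p: "\<bar>real (\<alpha> $ j) * mpow \<xi> (\<alpha> - munit j) * (E (y + position_part \<xi>) $ i - ?T i)\<bar> \<le> real (k * (k + 2)) * L * r ^ (k + 1)" for i j
  proof (cases "\<alpha> $ j = 0")
    case False
    then have m: "mlen (\<alpha> - munit j) = mlen \<alpha> - 1" "mlen \<alpha> \<ge> 1"
      using munit_diff_add by auto
    have mk: "?m \<le> k" using m \<alpha> by auto
    have "\<bar>E (y + position_part \<xi>) $ i - ?T i\<bar> \<le> real (?m + 2) * L * r ^ Suc ?m"
      using taylor_partials[of ?m "\<lambda>y. E y $ i" L "position_part \<xi>" r y] of_class_C_mono[OF C mk] L mk r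
      by (simp add: jet_def position_part_def)
    also have "\<dots> \<le> (k + 2) * L * r ^ Suc ?m"
      using mk L0 r0 by (intro mult_right_mono) auto
    finally have t: "\<bar>E (y + position_part \<xi>) $ i - ?T i\<bar> \<le> (k + 2) * L * r ^ Suc ?m" .
    have "\<bar>real (\<alpha> $ j) * mpow \<xi> (\<alpha> - munit j) * (E (y + position_part \<xi>) $ i - ?T i)\<bar> 
      \<le> k * r ^ (mlen \<alpha> - 1) * ((k + 2) * L * r ^ Suc ?m)"
      unfolding abs_mult
    proof (intro mult_mono t)
      show "\<bar>real (\<alpha> $ j)\<bar> \<le> real k" using nth_le_mlen[of \<alpha> j] \<alpha> by simp
      show "\<bar>mpow \<xi> (\<alpha> - munit j)\<bar> \<le> r ^ (mlen \<alpha> - 1)" using mpow_abs_le[of \<xi> r "\<alpha> - munit j"] r m by simp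
    qed (use r0 L0 in auto)
    also have "\<dots> = real (k * (k + 2)) * L * (r ^ (mlen \<alpha> - 1) * r ^ Suc ?m)" by (simp add: algebra_simps)
    also have "r ^ (mlen \<alpha> - 1) * r ^ Suc ?m = r ^ (k + 1)"
    proof -
      have "mlen \<alpha> - 1 + Suc ?m = k + 1" using m \<alpha> by auto
      then show ?thesis by (simp only: flip: power_add)
    qed
    finally show ?thesis .
  qed (use r0 L0 in auto)
  show ?thesis
    unfolding A0_sum_mpow using p[of 3 1] p[of 4 2] unfolding right_diff_distrib by linarith
qed

section \<open>Uniform constants for the derivatives of the field\<close>

lemma lipschitz_derivatives_uniform:
  assumes "lipschitz_derivatives k E"
  obtains L where "L \<ge> 0" 
    "\<And>i b\<^sub>1 b\<^sub>2. b\<^sub>1 + b\<^sub>2 \<le> k \<Longrightarrow> L-lipschitz_on UNIV (partials b\<^sub>1 b\<^sub>2 (\<lambda>y. E y $ i))"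
proof -
  define I where "I = {(i::2, b\<^sub>1, b\<^sub>2). b\<^sub>1 + b\<^sub>2 \<le> k}"
  have fin: "finite I"
    by (rule finite_subset[of _ "UNIV \<times> {..k} \<times> {..k}"]) (auto simp: I_def)
  have "\<forall>j\<in>I. \<exists>L. L-lipschitz_on UNIV (partials (fst (snd j)) (snd (snd j)) (\<lambda>y. E y $ (fst j)))"
    using assms unfolding lipschitz_derivatives_def I_def by auto
  then obtain L where L: "\<And>j. j \<in> I \<Longrightarrow> (L j)-lipschitz_on UNIV (partials (fst (snd j)) (snd (snd j)) (\<lambda>y. E y $ (fst j)))"
    by metis
  have L0: "L j \<ge> 0" if "j \<in> I" for j using L[OF that] lipschitz_on_nonneg by blast
  show ?thesis
  proof (rule that)
    show "(\<Sum>j\<in>I. L j) \<ge> 0" using L0 by (intro sum_nonneg)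
    fix i :: 2 and b\<^sub>1 b\<^sub>2 :: nat assume "b\<^sub>1 + b\<^sub>2 \<le> k"
    then have j: "(i, b\<^sub>1, b\<^sub>2) \<in> I" by (simp add: I_def)
    have "L (i, b\<^sub>1, b\<^sub>2) \<le> (\<Sum>j\<in>I. L j)" by (rule member_le_sum[OF j _ fin]) (use L0 in auto)
    with L[OF j] show "(\<Sum>j\<in>I. L j)-lipschitz_on UNIV (partials b\<^sub>1 b\<^sub>2 (\<lambda>y. E y $ i))"
      by (auto intro: lipschitz_on_le)
  qed
qed

lemma jet_bounded:
  assumes "\<And>i b\<^sub>1 b\<^sub>2. b\<^sub>1 + b\<^sub>2 \<le> k \<Longrightarrow> L-lipschitz_on UNIV (partials b\<^sub>1 b\<^sub>2 (\<lambda>y. E y $ i))"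
  obtains B where "B \<ge> 0" "\<And>i b\<^sub>1 b\<^sub>2 y. b\<^sub>1 + b\<^sub>2 \<le> k \<Longrightarrow> norm y \<le> R \<Longrightarrow> \<bar>jet E y i b\<^sub>1 b\<^sub>2\<bar> \<le> B"
proof -
  define c where "c = (\<Sum>i\<in>UNIV. \<Sum>b\<^sub>1\<le>k. \<Sum>b\<^sub>2\<le>k. \<bar>jet E 0 i b\<^sub>1 b\<^sub>2\<bar>)"
  have L0: "L \<ge> 0" using assms[of 0 0] lipschitz_on_nonneg by auto
  show ?thesis
  proof (rule that)
    show "c + L * \<bar>R\<bar> \<ge> 0" using L0 by (auto simp: c_def intro!: add_nonneg_nonneg sum_nonneg)
    fix i b\<^sub>1 b\<^sub>2 and y :: "real ^ 2" assume b: "b\<^sub>1 + b\<^sub>2 \<le> k" and y: "norm y \<le> R"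
    have "\<bar>jet E 0 i b\<^sub>1 b\<^sub>2\<bar> \<le> (\<Sum>b\<^sub>2\<le>k. \<bar>jet E 0 i b\<^sub>1 b\<^sub>2\<bar>)"
      using b by (intro member_le_sum[where f = "\<lambda>b\<^sub>2. \<bar>jet E 0 i b\<^sub>1 b\<^sub>2\<bar>"]) auto
    also have "\<dots> \<le> (\<Sum>b\<^sub>1\<le>k. \<Sum>b\<^sub>2\<le>k. \<bar>jet E 0 i b\<^sub>1 b\<^sub>2\<bar>)"
      using b by (intro member_le_sum[where f = "\<lambda>b\<^sub>1. \<Sum>b\<^sub>2\<le>k. \<bar>jet E 0 i b\<^sub>1 b\<^sub>2\<bar>"] sum_nonneg) auto
    also have "\<dots> \<le> c"
      unfolding c_def by (intro member_le_sum[where f = "\<lambda>i. \<Sum>b\<^sub>1\<le>k. \<Sum>b\<^sub>2\<le>k. \<bar>jet E 0 i b\<^sub>1 b\<^sub>2\<bar>"] sum_nonneg) auto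
    finally have "\<bar>jet E 0 i b\<^sub>1 b\<^sub>2\<bar> \<le> c" .
    moreover have "\<bar>jet E y i b\<^sub>1 b\<^sub>2 - jet E 0 i b\<^sub>1 b\<^sub>2\<bar> \<le> L * norm y"
      using lipschitz_onD[OF assms[OF b], of y 0 i] by (simp add: jet_def dist_real_def)
    moreover have "L * norm y \<le> L * \<bar>R\<bar>" using L0 y by (intro mult_left_mono) auto
    ultimately show "\<bar>jet E y i b\<^sub>1 b\<^sub>2\<bar> \<le> c + L * \<bar>R\<bar>" by linarith
  qed
qed

section \<open>One step of the integrator\<close>

text \<open>The fast linear flow conserves the guiding centre \<open>(q\<^sub>1 + q\<^sub>4, q\<^sub>2 - q\<^sub>3)\<close> and rotates
  \<open>(q\<^sub>3, q\<^sub>4)\<close>, so it is an isometry for this norm.\<close>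

definition gnorm :: "real ^ 4 \<Rightarrow> real" where
  "gnorm q = norm (Complex (q $ 1 + q $ 4) (q $ 2 - q $ 3)) + norm (Complex (q $ 3) (q $ 4))"

lemma gnorm_nonneg: "gnorm q \<ge> 0"
  by (simp add: gnorm_def)

lemma nth_le_gnorm: "\<bar>q $ i\<bar> \<le> gnorm q"
proof -
  have "\<bar>q $ 1 + q $ 4\<bar> \<le> norm (Complex (q $ 1 + q $ 4) (q $ 2 - q $ 3))"
    "\<bar>q $ 2 - q $ 3\<bar> \<le> norm (Complex (q $ 1 + q $ 4) (q $ 2 - q $ 3))"
    "\<bar>q $ 3\<bar> \<le> norm (Complex (q $ 3) (q $ 4))" "\<bar>q $ 4\<bar> \<le> norm (Complex (q $ 3) (q $ 4))"
    using abs_Re_le_cmod[of "Complex (q $ 1 + q $ 4) (q $ 2 - q $ 3)"] abs_Im_le_cmod[of "Complex (q $ 1 + q $ 4) (q $ 2 - q $ 3)"]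
      abs_Re_le_cmod[of "Complex (q $ 3) (q $ 4)"] abs_Im_le_cmod[of "Complex (q $ 3) (q $ 4)"] by simp_all
  then show ?thesis using exhaust_4[of i] unfolding gnorm_def by auto
qed

text \<open>The terms of size \<open>1 / \<epsilon>\<close> cancel in the guiding centre, and
  multiplication by \<open>cis (t / \<epsilon>)\<close> undoes the rotation of the velocity part.
  What remains is the integral of the forcing. The factor 1 before the initial norm is what keeps
  the error from being multiplied by a fixed constant at every step.\<close>

lemma rotating_gnorm_le:
  assumes h: "h \<ge> 0" and \<epsilon>: "\<epsilon> \<noteq> 0"
    and d: "\<And>t. t \<in> {s..s+h} \<Longrightarrow> ((\<lambda>t. q t $ 1) has_real_derivative q t $ 3 / \<epsilon> + p t $ 1) (at t within {s..s+h})"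
      "\<And>t. t \<in> {s..s+h} \<Longrightarrow> ((\<lambda>t. q t $ 2) has_real_derivative q t $ 4 / \<epsilon> + p t $ 2) (at t within {s..s+h})"
      "\<And>t. t \<in> {s..s+h} \<Longrightarrow> ((\<lambda>t. q t $ 3) has_real_derivative q t $ 4 / \<epsilon> + p t $ 3) (at t within {s..s+h})"
      "\<And>t. t \<in> {s..s+h} \<Longrightarrow> ((\<lambda>t. q t $ 4) has_real_derivative - q t $ 3 / \<epsilon> + p t $ 4) (at t within {s..s+h})"
    and p: "\<And>t i. t \<in> {s..s+h} \<Longrightarrow> \<bar>p t $ i\<bar> \<le> b"
  shows "gnorm (q (s + h)) \<le> gnorm (q s) + 6 * b * h"
proof -
  note d' = d[unfolded has_real_derivative_iff_has_vector_derivative]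
  have cx: "((\<lambda>t. Complex (f t) (g t)) has_vector_derivative Complex f' g') net"
    if "(f has_vector_derivative f') net" "(g has_vector_derivative g') net" for f g f' g' and net :: "real filter"
    using that by (simp add: has_vector_derivative_complex_iff has_real_derivative_iff_has_vector_derivative)
  let ?G = "\<lambda>t. Complex (q t $ 1 + q t $ 4) (q t $ 2 - q t $ 3)"
  let ?W = "\<lambda>t. Complex (q t $ 3) (q t $ 4)"
  let ?e = "\<lambda>t. cis (t / \<epsilon>)"
  have "norm (?G (s + h) - ?G s) \<le> (4 * b) * norm (s + h - s)"
  proof (rule vector_differentiable_bound[where S = "{s..s+h}"])
    fix t assume t: "t \<in> {s..s+h}"
    show "(?G has_vector_derivative Complex (p t $ 1 + p t $ 4) (p t $ 2 - p t $ 3)) (at t within {s..s+h})"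
      using cx[OF has_vector_derivative_add[OF d'(1)[OF t] d'(4)[OF t]] has_vector_derivative_diff[OF d'(2)[OF t] d'(3)[OF t]]]
      by (simp add: algebra_simps)
    show "norm (Complex (p t $ 1 + p t $ 4) (p t $ 2 - p t $ 3)) \<le> 4 * b"
      using cmod_le[of "Complex (p t $ 1 + p t $ 4) (p t $ 2 - p t $ 3)"] p[OF t, of 1] p[OF t, of 2] p[OF t, of 3] p[OF t, of 4] by simp
  qed (use h in auto)
  then have G: "norm (?G (s + h)) \<le> norm (?G s) + 4 * b * h"
    using norm_triangle_ineq2[of "?G (s + h)" "?G s"] h by simp
  have "norm (?e (s + h) * ?W (s + h) - ?e s * ?W s) \<le> (2 * b) * norm (s + h - s)"
  proof (rule vector_differentiable_bound[where S = "{s..s+h}"])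
    fix t assume t: "t \<in> {s..s+h}"
    have "((\<lambda>t. ?e t) has_vector_derivative (1 / \<epsilon>) *\<^sub>R (\<i> * ?e t)) (at t within {s..s+h})"
      unfolding has_vector_derivative_def by (auto intro!: derivative_eq_intros simp: \<epsilon>)
    from has_vector_derivative_mult[OF this cx[OF d'(3)[OF t] d'(4)[OF t]]]
    show "((\<lambda>t. ?e t * ?W t) has_vector_derivative ?e t * Complex (p t $ 3) (p t $ 4)) (at t within {s..s+h})"
      by (rule has_vector_derivative_eq_rhs) (simp add: complex_eq_iff algebra_simps)
    show "norm (?e t * Complex (p t $ 3) (p t $ 4)) \<le> 2 * b"
      using cmod_le[of "Complex (p t $ 3) (p t $ 4)"] p[OF t, of 3] p[OF t, of 4] by (simp add: norm_mult)
  qed (use h in auto)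
  then have W: "norm (?W (s + h)) \<le> norm (?W s) + 2 * b * h"
    using norm_triangle_ineq2[of "?e (s + h) * ?W (s + h)" "?e s * ?W s"] h by (simp add: norm_mult)
  show ?thesis using G W unfolding gnorm_def by (simp add: algebra_simps)
qed

section \<open>The scheme in the scaled phase variables\<close>

definition phase :: "real \<Rightarrow> real ^ 2 \<Rightarrow> real ^ 2 \<Rightarrow> real ^ 4" where
  "phase \<epsilon> y z = vector [y $ 1, y $ 2, \<epsilon> * z $ 1, \<epsilon> * z $ 2]"

lemma phase_nth [simp]: "phase \<epsilon> y z $ 1 = y $ 1" "phase \<epsilon> y z $ 2 = y $ 2" 
  "phase \<epsilon> y z $ 3 = \<epsilon> * z $ 1" "phase \<epsilon> y z $ 4 = \<epsilon> * z $ 2"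
  by (simp_all add: phase_def)

lemma position_part_phase: "position_part (phase \<epsilon> y z) = y"
  by (simp add: position_part_def vec_eq_iff forall_2)

text \<open>The column at 0 of the exponential for \<open>\<nu> = 0\<close>, with the time
  \<open>\<tau>\<close> kept as a variable so that the step can be studied as the solution of a
  frozen linear system.\<close>

definition lle_step :: "nat \<Rightarrow> (real ^ 2 \<Rightarrow> real ^ 2) \<Rightarrow> real \<Rightarrow> real \<Rightarrow> real ^ 4 \<Rightarrow> mindex \<Rightarrow> real" where
  "lle_step k E \<epsilon> \<tau> X \<alpha> = mat_exp (mindices k) (\<lambda>\<alpha> \<gamma>. (A1 k X \<alpha> \<gamma> / \<epsilon> + \<epsilon> * A0 k E X \<alpha> \<gamma>) * \<tau>) \<alpha> 0"

lemma lle_step_0: "lle_step k E \<epsilon> 0 X \<alpha> = (if \<alpha> = 0 then 1 else 0)"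
  unfolding lle_step_def mat_exp_zero by (simp add: unit_vec_def)

lemma lle_step_has_derivative:
  assumes "mlen \<alpha> \<le> k"
  shows "((\<lambda>\<tau>. lle_step k E \<epsilon> \<tau> X \<alpha>) has_real_derivative 
    A1_action X (lle_step k E \<epsilon> \<tau> X) \<alpha> / \<epsilon> + \<epsilon> * A0_action k E X (lle_step k E \<epsilon> \<tau> X) \<alpha>) (at \<tau>)"
proof -
  have \<alpha>: "\<alpha> \<in> mindices k" using assms by (simp add: mindices_def)
  have "mat_app (mindices k) (\<lambda>\<alpha> \<gamma>. A1 k X \<alpha> \<gamma> / \<epsilon> + \<epsilon> * A0 k E X \<alpha> \<gamma>) v \<alpha> = A1_action X v \<alpha> / \<epsilon> + \<epsilon> * A0_action k E X v \<alpha>" for v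
    unfolding mat_app_A1[OF \<alpha>, symmetric] mat_app_A0[OF \<alpha>, symmetric] mat_app_def
    by (simp add: distrib_right sum.distrib sum_distrib_left sum_divide_distrib mult.assoc)
  then show ?thesis
    using mat_exp_has_derivative[OF finite_mindices \<alpha>, of "\<lambda>\<alpha> \<gamma>. A1 k X \<alpha> \<gamma> / \<epsilon> + \<epsilon> * A0 k E X \<alpha> \<gamma>" 0 \<tau>]
    by (simp add: lle_step_def[abs_def])
qed

lemma lle_state_Suc:
  assumes "\<epsilon> > 0"
  shows "lle_state k E 0 \<epsilon> h y\<^sub>0 z\<^sub>0 (Suc n) = lle_state k E 0 \<epsilon> h y\<^sub>0 z\<^sub>0 n 
    + proj_x (lle_step k E \<epsilon> h (lle_state k E 0 \<epsilon> h y\<^sub>0 z\<^sub>0 n))"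
proof -
  have 0: "(0::mindex) \<in> mindices k" by (simp add: mindices_def mlen_def)
  have app: "mat_app (mindices k) M (unit_vec 0) = (\<lambda>\<alpha>. M \<alpha> 0)" for M
    by (rule ext) (rule mat_app_unit_vec[OF finite_mindices 0])
  show ?thesis
    using assms by (simp add: Let_def app lle_step_def[abs_def] power_int_minus field_simps)
qed

text \<open>The difference \<open>v - v'\<close> is paired with the numerical state
  \<open>w\<close>, and the perturbation \<open>x - w\<close> with the exact monomials, whose bounds
  are known.\<close>

lemma lower_add: "lower x v \<alpha> - lower w v' \<alpha> = lower w (\<lambda>\<alpha>. v \<alpha> - v' \<alpha>) \<alpha> + lower (x - w) v \<alpha>"
  by (simp add: lower_def algebra_simps)

lemma lower_0: "lower x v 0 = 0"
  by (simp add: lower_def)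

lemma lower_munit:
  "lower x v (munit 1) = x $ 3 * v 0" "lower x v (munit 2) = x $ 4 * v 0"
  "lower x v (munit 3) = x $ 4 * v 0" "lower x v (munit 4) = - x $ 3 * v 0"
  by (simp_all add: lower_def axis_nth_neq)

lemma rot_0: "rot v 0 = 0"
  by (simp add: rot_def)

lemma rot_munit:
  "rot v (munit 1) = v (munit 3)" "rot v (munit 2) = v (munit 4)"
  "rot v (munit 3) = v (munit 4)" "rot v (munit 4) = - v (munit 3)"
  by (simp_all add: rot_def axis_nth_neq)

lemma rot_diff: "rot v \<alpha> - rot w \<alpha> = rot (\<lambda>\<alpha>. v \<alpha> - w \<alpha>) \<alpha>"
  by (simp add: rot_def algebra_simps)

lemma norm_position_part_le: "norm (position_part x) \<le> \<bar>x $ 1\<bar> + \<bar>x $ 2\<bar>"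
  using norm_le_l1_cart[of "position_part x"] by (simp add: sum_2 position_part_def)

lemma position_part_diff: "position_part (x - w) = position_part x - position_part w"
  by (simp add: position_part_def vec_eq_iff forall_2)

lemma jet_diff_le:
  assumes "L-lipschitz_on UNIV (partials b\<^sub>1 b\<^sub>2 (\<lambda>y. E y $ i))"
  shows "\<bar>jet E y i b\<^sub>1 b\<^sub>2 - jet E y' i b\<^sub>1 b\<^sub>2\<bar> \<le> L * norm (y - y')"
  using lipschitz_onD[OF assms, of y y'] by (simp add: jet_def dist_real_def dist_norm)

text \<open>The propagator bound for all components loses a factor \<open>1 / \<epsilon>\<close> on
  the initial error and is therefore used only inside the slow terms \<open>H\<close>. In degree one
  the state error obeys the fast flow with forcing \<open>\<epsilon> * H\<close>, so the isometric
  norm applies and the lost factor is regained.\<close>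

lemma one_step:
  assumes k: "k \<ge> 1" and cC: "\<And>i. of_class_C k (\<lambda>y. E y $ i)" 
    and L: "\<And>i b\<^sub>1 b\<^sub>2. b\<^sub>1 + b\<^sub>2 \<le> k \<Longrightarrow> L-lipschitz_on UNIV (partials b\<^sub>1 b\<^sub>2 (\<lambda>y. E y $ i))"
    and K: "K \<ge> 1"
  obtains C where "C \<ge> 0"
    "\<And>\<epsilon> y z X s h. \<lbrakk>0 < \<epsilon>; \<epsilon> \<le> 1; 0 \<le> h; h \<le> T;
      \<And>t. t \<in> {s..s+h} \<Longrightarrow> (y has_vector_derivative z t) (at t within {s..s+h});
      \<And>t. t \<in> {s..s+h} \<Longrightarrow> (z has_vector_derivative (1 / \<epsilon>) *\<^sub>R (J *v z t) + E (y t)) (at t within {s..s+h});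
      \<And>t. t \<in> {s..s+h} \<Longrightarrow> norm (y t) \<le> K \<and> norm (z t) \<le> K 
        \<and> norm (y t - y s) \<le> K * min \<epsilon> h \<and> \<epsilon> * norm (z t - z s) \<le> K * min \<epsilon> h;
      gnorm (phase \<epsilon> (y s) (z s) - X) \<le> \<epsilon>\<rbrakk>
      \<Longrightarrow> gnorm (phase \<epsilon> (y (s + h)) (z (s + h)) - (X + proj_x (lle_step k E \<epsilon> h X)))
        \<le> gnorm (phase \<epsilon> (y s) (z s) - X) + C * h * (gnorm (phase \<epsilon> (y s) (z s) - X) + \<epsilon> * min \<epsilon> h ^ (k + 1))"
proof -
  \<comment> \<open>The numerical position lies within \<open>2 * \<epsilon> \<le> 2\<close> of the
    exact one, hence the radius \<open>K + 2\<close>.\<close>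
  obtain B where B: "B \<ge> 0" "\<And>i b\<^sub>1 b\<^sub>2 y. b\<^sub>1 + b\<^sub>2 \<le> k \<Longrightarrow> norm y \<le> K + 2 \<Longrightarrow> \<bar>jet E y i b\<^sub>1 b\<^sub>2\<bar> \<le> B"
    using jet_bounded[OF L] by blast
  have L0: "L \<ge> 0" using L[of 0 0] lipschitz_on_nonneg by auto
  define c where "c = real (card (mindices (k + 1))) * (2 * k)"
  \<comment> \<open>\<open>a\<close> is the growth rate from the lowering part and the slow part.
    \<open>a2\<close> measures the perturbed derivatives and the Taylor remainder, and
    \<open>a3\<close> adds the perturbed lowering part.\<close>
  define a where "a = 4 * k * (K + 1) + c * B"
  define a2 where "a2 = c * (2 * L) * K ^ k + 2 * real (k * (k + 2)) * L * K ^ (k + 1)"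
  define a3 where "a3 = 4 * k * K ^ k + a2"
  have c0: "c \<ge> 0" by (simp add: c_def)
  have a0: "a \<ge> 0" using B K c0 by (simp add: a_def)
  have a20: "a2 \<ge> 0" using L0 K c0 by (simp add: a2_def)
  have a30: "a3 \<ge> 0" using a20 K by (simp add: a3_def)
  obtain Q where Q: "Q > 0"
    "\<And>\<epsilon> s h \<rho> u f \<alpha> t. \<lbrakk>h \<le> T; \<rho> \<ge> 0; t \<in> {s..s+h}; mlen \<alpha> \<le> k;
      \<And>\<alpha>. mlen \<alpha> \<le> k \<Longrightarrow> u s \<alpha> = 0;
      \<And>\<alpha> t. t \<in> {s..s+h} \<Longrightarrow> mlen \<alpha> \<le> k \<Longrightarrow> 
        ((\<lambda>t. u t \<alpha>) has_vector_derivative rot (u t) \<alpha> / \<epsilon> + f t \<alpha>) (at t within {s..s+h});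
      \<And>\<alpha> t U. t \<in> {s..s+h} \<Longrightarrow> mlen \<alpha> \<le> k \<Longrightarrow> (\<And>\<alpha>. mlen \<alpha> \<le> k \<Longrightarrow> \<bar>u t \<alpha>\<bar> \<le> U) 
        \<Longrightarrow> \<bar>f t \<alpha>\<bar> \<le> a * U + \<rho>\<rbrakk>
      \<Longrightarrow> \<bar>u t \<alpha>\<bar> \<le> Q * (\<rho>::real)"
    using propagator_bound[OF a0, of T k] by blast
  define C where "C = 6 * (c * B * Q * a3 + a2)"
  show ?thesis
  proof (rule that)
    show "C \<ge> 0" using c0 B a30 a20 Q(1) by (simp add: C_def)
    fix \<epsilon> s h :: real and y z :: "real \<Rightarrow> real ^ 2" and X :: "real ^ 4"
    assume \<epsilon>: "0 < \<epsilon>" "\<epsilon> \<le> 1" and h: "0 \<le> h" "h \<le> T"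
      and dy: "\<And>t. t \<in> {s..s+h} \<Longrightarrow> (y has_vector_derivative z t) (at t within {s..s+h})"
      and dz: "\<And>t. t \<in> {s..s+h} \<Longrightarrow> (z has_vector_derivative (1 / \<epsilon>) *\<^sub>R (J *v z t) + E (y t)) (at t within {s..s+h})"
      and bd: "\<And>t. t \<in> {s..s+h} \<Longrightarrow> norm (y t) \<le> K \<and> norm (z t) \<le> K 
        \<and> norm (y t - y s) \<le> K * min \<epsilon> h \<and> \<epsilon> * norm (z t - z s) \<le> K * min \<epsilon> h"
      and e1: "gnorm (phase \<epsilon> (y s) (z s) - X) \<le> \<epsilon>"
    define m where "m = min \<epsilon> h"
    define x where "x = (\<lambda>t. phase \<epsilon> (y t) (z t))"
    define \<delta> where "\<delta> = x s - X"
    define e where "e = gnorm \<delta>"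
    define \<xi> where "\<xi> = (\<lambda>t. x t - x s)"
    define W where "W = (\<lambda>t. mpow (\<xi> t))"
    define V where "V = (\<lambda>t. lle_step k E \<epsilon> (t - s) X)"
    define u where "u = (\<lambda>t \<alpha>. W t \<alpha> - V t \<alpha>)"
    define P where "P = jet E (position_part X)"
    define P' where "P' = jet E (y s)"
    \<comment> \<open>\<open>R\<close> is the Taylor remainder of the force, \<open>H\<close>
      collects the slow terms, and \<open>f\<close> is all of the derivative of \<open>u\<close>
      except the fast rotation.\<close>
    define R where "R = (\<lambda>t \<alpha>. real (\<alpha> $ 3) * W t (\<alpha> - munit 3) * E (y t) $ 1
      + real (\<alpha> $ 4) * W t (\<alpha> - munit 4) * E (y t) $ 2 - A0_sum k P' (W t) \<alpha>)"
    define H where "H = (\<lambda>t \<alpha>. A0_sum k P (u t) \<alpha> + A0_sum k (\<lambda>i b\<^sub>1 b\<^sub>2. P' i b\<^sub>1 b\<^sub>2 - P i b\<^sub>1 b\<^sub>2) (W t) \<alpha> + R t \<alpha>)"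
    define f where "f = (\<lambda>t \<alpha>. (lower X (u t) \<alpha> + lower \<delta> (W t) \<alpha>) / \<epsilon> + \<epsilon> * H t \<alpha>)"
    define \<rho> where "\<rho> = a3 * (e / \<epsilon> + \<epsilon> * m ^ (k + 1))"
    have s: "s \<in> {s..s+h}" using h by simp
    have m: "0 \<le> m" "m \<le> 1" using \<epsilon> h by (auto simp: m_def)
    have e: "0 \<le> e" "e \<le> \<epsilon>" using e1 gnorm_nonneg by (auto simp: e_def \<delta>_def x_def)
    have \<rho>: "\<rho> \<ge> 0" using a30 e \<epsilon> m by (simp add: \<rho>_def)
    have \<delta>: "\<bar>\<delta> $ i\<bar> \<le> e" for i by (simp add: e_def nth_le_gnorm)
    have comp: "\<bar>w $ i\<bar> \<le> r" if "norm w \<le> r" for w :: "real ^ 2" and i r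
      using component_le_norm_cart[of w i] that by linarith
    have \<xi>: "\<bar>\<xi> t $ i\<bar> \<le> K * m" if t: "t \<in> {s..s+h}" for t i
    proof -
      have "norm (y t - y s) \<le> K * m" "norm (\<epsilon> *\<^sub>R (z t - z s)) \<le> K * m" 
        using bd[OF t] \<epsilon> by (auto simp: m_def)
      from comp[OF this(1)] comp[OF this(2)] show ?thesis
        using exhaust_4[of i] by (auto simp: \<xi>_def x_def right_diff_distrib)
    qed
    have WK: "\<bar>W t \<alpha>\<bar> \<le> K ^ k" if t: "t \<in> {s..s+h}" and \<alpha>: "mlen \<alpha> \<le> k" for t \<alpha>
    proof -
      have "K * m \<le> K * 1" using m K by (intro mult_left_mono) auto
      then have "\<bar>W t \<alpha>\<bar> \<le> K ^ mlen \<alpha>"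
        unfolding W_def using \<xi>[OF t] by (intro mpow_abs_le) (metis mult_1_right order_trans)
      also have "\<dots> \<le> K ^ k" using \<alpha> K by (intro power_increasing)
      finally show ?thesis .
    qed
    \<comment> \<open>The smallness assumption \<open>e \<le> \<epsilon>\<close> keeps the scaled
      numerical velocity of order \<open>\<epsilon>\<close>, which compensates the division of the
      lowering part by \<open>\<epsilon>\<close>.\<close>
    have X34: "\<bar>X $ i\<bar> \<le> (K + 1) * \<epsilon>" if "i = 3 \<or> i = 4" for i
    proof -
      have "\<bar>x s $ i\<bar> \<le> \<epsilon> * K"
        using that comp[of "z s" K 1] comp[of "z s" K 2] bd[OF s] \<epsilon> by (auto simp: x_def abs_mult)
      moreover have "\<bar>x s $ i - X $ i\<bar> \<le> \<epsilon>" using \<delta>[of i] e by (simp add: \<delta>_def)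
      ultimately show ?thesis by (simp add: algebra_simps) 
    qed
    have ys: "norm (y s - position_part X) \<le> 2 * e"
      using norm_position_part_le[of \<delta>] \<delta>[of 1] \<delta>[of 2] by (simp add: \<delta>_def position_part_diff x_def position_part_phase)
    have PB: "\<bar>P i b\<^sub>1 b\<^sub>2\<bar> \<le> B" if "b\<^sub>1 + b\<^sub>2 \<le> k" for i b\<^sub>1 b\<^sub>2
    proof -
      have "norm (position_part X) \<le> K + 2"
        using ys e \<epsilon> bd[OF s] norm_triangle_ineq2[of "position_part X" "y s"] by (simp add: norm_minus_commute)
      then show ?thesis unfolding P_def using B(2) that by blast
    qed
    have PP: "\<bar>P' i b\<^sub>1 b\<^sub>2 - P i b\<^sub>1 b\<^sub>2\<bar> \<le> 2 * L * e" if "b\<^sub>1 + b\<^sub>2 \<le> k" for i b\<^sub>1 b\<^sub>2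
      using jet_diff_le[OF L[OF that], of "y s" i "position_part X"] mult_left_mono[OF ys L0] by (simp add: P_def P'_def)
    have Rb: "\<bar>R t \<alpha>\<bar> \<le> 2 * real (k * (k + 2)) * L * K ^ (k + 1) * m ^ (k + 1)" if t: "t \<in> {s..s+h}" and \<alpha>: "mlen \<alpha> \<le> k" for t \<alpha>
    proof -
      have "y t = y s + position_part (\<xi> t)"
        by (simp add: \<xi>_def x_def position_part_diff position_part_phase)
      then show ?thesis
        using A0_sum_remainder[OF cC L \<alpha> \<xi>[OF t], of "y s"] by (simp add: R_def W_def P'_def power_mult_distrib mult.assoc)
    qed
    have Hb: "\<bar>H t \<alpha>\<bar> \<le> c * B * U + a2 * (e + m ^ (k + 1))" 
      if t: "t \<in> {s..s+h}" and \<alpha>: "mlen \<alpha> \<le> k" and U: "\<And>\<alpha>. mlen \<alpha> \<le> k \<Longrightarrow> \<bar>u t \<alpha>\<bar> \<le> U" for t \<alpha> U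
    proof -
      have "\<bar>A0_sum k P (u t) \<alpha>\<bar> \<le> c * B * U"
        using A0_sum_abs_le[OF \<alpha> PB U] by (simp add: c_def mult.assoc)
      moreover have "\<bar>A0_sum k (\<lambda>i b\<^sub>1 b\<^sub>2. P' i b\<^sub>1 b\<^sub>2 - P i b\<^sub>1 b\<^sub>2) (W t) \<alpha>\<bar> \<le> c * (2 * L * e) * K ^ k"
        using A0_sum_abs_le[OF \<alpha> PP WK[OF t]] by (simp add: c_def mult.assoc)
      ultimately have "\<bar>H t \<alpha>\<bar> \<le> c * B * U + c * (2 * L * e) * K ^ k + 2 * real (k * (k + 2)) * L * K ^ (k + 1) * m ^ (k + 1)"
        using Rb[OF t \<alpha>] unfolding H_def by linarith
      also have "\<dots> \<le> c * B * U + a2 * (e + m ^ (k + 1))"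
      proof -
        have "0 \<le> c * (2 * L) * K ^ k * m ^ (k + 1)" "0 \<le> 2 * real (k * (k + 2)) * L * K ^ (k + 1) * e"
          using c0 L0 K m e by auto
        then show ?thesis unfolding a2_def by (simp only: distrib_left distrib_right mult_ac)
      qed
      finally show ?thesis .
    qed
    have du: "((\<lambda>t. u t \<alpha>) has_real_derivative rot (u t) \<alpha> / \<epsilon> + f t \<alpha>) (at t within {s..s+h})" 
      if t: "t \<in> {s..s+h}" and \<alpha>: "mlen \<alpha> \<le> k" for t \<alpha>
    proof -
      define d where "d = phase \<epsilon> (z t) ((1 / \<epsilon>) *\<^sub>R (J *v z t) + E (y t))"
      note cmp = bounded_linear.has_vector_derivative[OF bounded_linear_vec_nth]
      have d\<xi>: "((\<lambda>t. \<xi> t $ i) has_real_derivative d $ i) (at t within {s..s+h})" for i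
      proof -
        have "((\<lambda>t. y t $ j) has_real_derivative z t $ j) (at t within {s..s+h})"
          "((\<lambda>t. z t $ j) has_real_derivative ((1 / \<epsilon>) *\<^sub>R (J *v z t) + E (y t)) $ j) (at t within {s..s+h})" for j
          unfolding has_real_derivative_iff_has_vector_derivative by (intro cmp dy[OF t] cmp dz[OF t])+
        then have "((\<lambda>t. x t $ i) has_real_derivative d $ i) (at t within {s..s+h})"
          unfolding x_def d_def using exhaust_4[of i] by (auto intro!: DERIV_cmult)
        then show ?thesis unfolding \<xi>_def by (auto intro!: derivative_eq_intros)
      qed
      have dW: "((\<lambda>t. W t \<alpha>) has_real_derivative (\<Sum>i\<in>UNIV. real (\<alpha> $ i) * d $ i * W t (\<alpha> - munit i))) (at t within {s..s+h})"
        unfolding W_def by (rule mpow_has_derivative[OF d\<xi>])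
      have sh: "W t (\<alpha> - munit j + munit i) = W t (\<alpha> - munit j) * \<xi> t $ i" for i j
        by (simp add: W_def mpow_add)
      have d: "d $ 1 = (\<xi> t $ 3 + x s $ 3) / \<epsilon>" "d $ 2 = (\<xi> t $ 4 + x s $ 4) / \<epsilon>"
        "d $ 3 = (\<xi> t $ 4 + x s $ 4) / \<epsilon> + \<epsilon> * E (y t) $ 1" "d $ 4 = - (\<xi> t $ 3 + x s $ 3) / \<epsilon> + \<epsilon> * E (y t) $ 2"
        using \<epsilon> by (simp_all add: d_def \<xi>_def x_def J_vec field_simps)
      have W': "(\<Sum>i\<in>UNIV. real (\<alpha> $ i) * d $ i * W t (\<alpha> - munit i)) = 
        (rot (W t) \<alpha> + lower (x s) (W t) \<alpha>) / \<epsilon> + \<epsilon> * (real (\<alpha> $ 3) * W t (\<alpha> - munit 3) * E (y t) $ 1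
          + real (\<alpha> $ 4) * W t (\<alpha> - munit 4) * E (y t) $ 2)"
        unfolding sum_4 d rot_def lower_def sh by (simp add: algebra_simps add_divide_distrib diff_divide_distrib)
      have "((\<lambda>t. V t \<alpha>) has_real_derivative (A1_action X (V t) \<alpha> / \<epsilon> + \<epsilon> * A0_action k E X (V t) \<alpha>) * 1) (at t within {s..s+h})"
        unfolding V_def by (rule DERIV_chain2[OF lle_step_has_derivative[OF \<alpha>]]) (auto intro!: derivative_eq_intros)
      from DERIV_diff[OF dW this]
      have "((\<lambda>t. u t \<alpha>) has_real_derivative 
        (rot (W t) \<alpha> - rot (V t) \<alpha> + (lower (x s) (W t) \<alpha> - lower X (V t) \<alpha>)) / \<epsilon> 
        + \<epsilon> * (R t \<alpha> + (A0_sum k P' (W t) \<alpha> - A0_sum k P (W t) \<alpha>) + (A0_sum k P (W t) \<alpha> - A0_sum k P (V t) \<alpha>))) (at t within {s..s+h})"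
        unfolding W' A1_action_eq A0_action_eq u_def R_def P_def 
        by (rule DERIV_cong) (simp add: algebra_simps add_divide_distrib diff_divide_distrib)
      moreover have "(\<lambda>\<alpha>. W t \<alpha> - V t \<alpha>) = u t" by (simp add: u_def)
      ultimately show ?thesis
        unfolding rot_diff lower_add A0_sum_diff 
        by (elim DERIV_cong) (simp add: f_def H_def \<delta>_def algebra_simps add_divide_distrib)
    qed
    have fb: "\<bar>f t \<alpha>\<bar> \<le> a * U + \<rho>" 
      if t: "t \<in> {s..s+h}" and \<alpha>: "mlen \<alpha> \<le> k" and U: "\<And>\<alpha>. mlen \<alpha> \<le> k \<Longrightarrow> \<bar>u t \<alpha>\<bar> \<le> U" for t \<alpha> U
    proof -
      have U0: "U \<ge> 0" using U[of 0] abs_ge_zero[of "u t 0"] by (simp add: mlen_def)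
      have 1: "\<bar>lower X (u t) \<alpha>\<bar> \<le> 4 * k * ((K + 1) * \<epsilon>) * U"
        using lower_abs_le[OF \<alpha> U X34 X34] by simp
      have 2: "\<bar>lower \<delta> (W t) \<alpha>\<bar> \<le> 4 * k * e * K ^ k"
        using lower_abs_le[OF \<alpha> WK[OF t] \<delta> \<delta>] by simp
      have "\<bar>f t \<alpha>\<bar> \<le> (\<bar>lower X (u t) \<alpha>\<bar> + \<bar>lower \<delta> (W t) \<alpha>\<bar>) / \<epsilon> + \<epsilon> * \<bar>H t \<alpha>\<bar>"
        unfolding f_def using \<epsilon> 
        by (intro order_trans[OF abs_triangle_ineq] add_mono) (auto simp: abs_mult divide_right_mono)
      also have "\<dots> \<le> (4 * k * ((K + 1) * \<epsilon>) * U + 4 * k * e * K ^ k) / \<epsilon> + \<epsilon> * (c * B * U + a2 * (e + m ^ (k + 1)))"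
        using \<epsilon> by (intro add_mono mult_left_mono divide_right_mono 1 2 Hb[OF t \<alpha> U]) auto
      also have "\<dots> = 4 * k * (K + 1) * U + \<epsilon> * (c * B * U) + (4 * k * K ^ k * (e / \<epsilon>) + a2 * (\<epsilon> * e + \<epsilon> * m ^ (k + 1)))"
        using \<epsilon> by (simp add: field_simps)
      \<comment> \<open>For \<open>\<epsilon> \<le> 1\<close> the slow contribution
        \<open>\<epsilon> * e\<close> is absorbed into \<open>e / \<epsilon>\<close>, so one
        quantity \<open>\<rho>\<close> covers all forcing.\<close>
      also have "\<dots> \<le> 4 * k * (K + 1) * U + 1 * (c * B * U) + (4 * k * K ^ k * (e / \<epsilon> + \<epsilon> * m ^ (k + 1)) + a2 * (e / \<epsilon> + \<epsilon> * m ^ (k + 1)))"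
      proof (intro add_mono mult_left_mono mult_right_mono order_refl)
        have "\<epsilon> * e \<le> 1 * e" using \<epsilon> e by (intro mult_right_mono) auto
        also have "1 * e \<le> e / \<epsilon>" using \<epsilon> e by (simp add: le_divide_eq mult_left_le)
        finally show "\<epsilon> * e \<le> e / \<epsilon>" .
      qed (use \<epsilon> c0 B U0 a20 K m e in auto)
      also have "\<dots> = a * U + \<rho>" by (simp add: a_def \<rho>_def a3_def algebra_simps)
      finally show ?thesis .
    qed
    have u0: "u s \<alpha> = 0" if "mlen \<alpha> \<le> k" for \<alpha>
    proof -
      have "mpow 0 \<alpha> = (if \<alpha> = 0 then 1 else 0)"
        by (auto simp: mpow_def vec_eq_iff forall_4)
      then show ?thesis by (simp add: u_def W_def V_def \<xi>_def lle_step_0)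
    qed
    have ub: "\<bar>u t \<alpha>\<bar> \<le> Q * \<rho>" if t: "t \<in> {s..s+h}" and \<alpha>: "mlen \<alpha> \<le> k" for t \<alpha>
      by (rule Q(2)[OF h(2) \<rho> t \<alpha> u0 du[unfolded has_real_derivative_iff_has_vector_derivative] fb])
    \<comment> \<open>The degree zero components of both vectors stay equal to 1, so in degree one
      the lowering part of \<open>u\<close> vanishes and only the constant
      \<open>\<delta> / \<epsilon>\<close> terms are left.\<close>
    have uz: "u t 0 = 0" if t: "t \<in> {s..s+h}" for t
    proof -
      have "norm (u t 0 - u s 0) \<le> 0 * norm (t - s)"
      proof (rule vector_differentiable_bound[where S = "{s..s+h}" and f' = "\<lambda>t. 0"])
        fix r assume r: "r \<in> {s..s+h}"
        have "((\<lambda>t. u t 0) has_real_derivative rot (u r) 0 / \<epsilon> + f r 0) (at r within {s..s+h})"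
          by (rule du[OF r]) (simp add: mlen_def)
        then show "((\<lambda>t. u t 0) has_vector_derivative 0) (at r within {s..s+h})"
          by (simp add: has_real_derivative_iff_has_vector_derivative rot_0 f_def lower_0 H_def A0_sum_0 R_def)
      qed (use t s in auto)
      then show ?thesis using u0[of 0] by (simp add: mlen_def)
    qed
    \<comment> \<open>Adding the constant \<open>\<delta>\<close> turns these terms into the fast
      flow of \<open>q\<close>. Thus \<open>q\<close> is the state error itself:
      \<open>\<delta>\<close> at the start of the step and the new error at its end.\<close>
    define q where "q = (\<lambda>t. (\<chi> i. u t (munit i)) + \<delta>)"
    have g: "gnorm (q (s + h)) \<le> gnorm (q s) + 6 * ((c * B * Q * a3 + a2) * (e + \<epsilon> * m ^ (k + 1))) * h"
    proof (rule rotating_gnorm_le[where \<epsilon> = \<epsilon> and p = "\<lambda>t. \<chi> i. \<epsilon> * H t (munit i)"])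
      fix t assume t: "t \<in> {s..s+h}"
      have dq: "((\<lambda>t. q t $ i) has_real_derivative rot (u t) (munit i) / \<epsilon> + f t (munit i)) (at t within {s..s+h})" for i
        unfolding q_def using k by (auto intro!: derivative_eq_intros du[OF t])
      have W0: "W t 0 = 1" by (simp add: W_def)
      note simps = f_def q_def rot_munit lower_munit uz[OF t] W0 add_divide_distrib
      show "((\<lambda>t. q t $ 1) has_real_derivative q t $ 3 / \<epsilon> + (\<chi> i. \<epsilon> * H t (munit i)) $ 1) (at t within {s..s+h})"
        using dq[of 1] by (rule DERIV_cong) (simp add: simps)
      show "((\<lambda>t. q t $ 2) has_real_derivative q t $ 4 / \<epsilon> + (\<chi> i. \<epsilon> * H t (munit i)) $ 2) (at t within {s..s+h})"
        using dq[of 2] by (rule DERIV_cong) (simp add: simps)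
      show "((\<lambda>t. q t $ 3) has_real_derivative q t $ 4 / \<epsilon> + (\<chi> i. \<epsilon> * H t (munit i)) $ 3) (at t within {s..s+h})"
        using dq[of 3] by (rule DERIV_cong) (simp add: simps)
      show "((\<lambda>t. q t $ 4) has_real_derivative - q t $ 3 / \<epsilon> + (\<chi> i. \<epsilon> * H t (munit i)) $ 4) (at t within {s..s+h})"
        using dq[of 4] by (rule DERIV_cong) (simp add: simps diff_divide_distrib)
      fix i
      have "\<bar>\<epsilon> * H t (munit i)\<bar> \<le> \<epsilon> * (c * B * (Q * \<rho>) + a2 * (e + m ^ (k + 1)))"
        unfolding abs_mult using \<epsilon> k by (intro mult_mono Hb[OF t _ ub[OF t]]) auto
      \<comment> \<open>The factor \<open>\<epsilon>\<close> in front of \<open>H\<close> cancels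
        the division by \<open>\<epsilon>\<close> in \<open>\<rho>\<close>.\<close>
      also have "\<dots> = c * B * Q * a3 * (\<epsilon> * (e / \<epsilon>) + \<epsilon> * (\<epsilon> * m ^ (k + 1))) + a2 * (\<epsilon> * e + \<epsilon> * m ^ (k + 1))"
        by (simp add: \<rho>_def algebra_simps)
      also have "\<dots> \<le> c * B * Q * a3 * (e + 1 * (\<epsilon> * m ^ (k + 1))) + a2 * (1 * e + \<epsilon> * m ^ (k + 1))"
        using \<epsilon> c0 B a20 a30 Q(1) e m by (intro add_mono mult_left_mono mult_right_mono mult_nonneg_nonneg) auto
      also have "\<dots> = (c * B * Q * a3 + a2) * (e + \<epsilon> * m ^ (k + 1))" by (simp add: algebra_simps)
      finally show "\<bar>(\<chi> i. \<epsilon> * H t (munit i)) $ i\<bar> \<le> (c * B * Q * a3 + a2) * (e + \<epsilon> * m ^ (k + 1))" by simp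
    qed (use h \<epsilon> in auto)
    have qs: "q s = \<delta>" 
      using u0 k by (simp add: q_def vec_eq_iff)
    have qh: "q (s + h) = x (s + h) - (X + proj_x (lle_step k E \<epsilon> h X))"
      by (simp add: q_def vec_eq_iff u_def W_def V_def \<xi>_def \<delta>_def proj_x_def)
    have C: "6 * ((c * B * Q * a3 + a2) * (e + \<epsilon> * m ^ (k + 1))) * h = C * h * (e + \<epsilon> * m ^ (k + 1))"
      by (simp only: C_def mult_ac)
    from g show "gnorm (phase \<epsilon> (y (s + h)) (z (s + h)) - (X + proj_x (lle_step k E \<epsilon> h X)))
        \<le> gnorm (phase \<epsilon> (y s) (z s) - X) + C * h * (gnorm (phase \<epsilon> (y s) (z s) - X) + \<epsilon> * min \<epsilon> h ^ (k + 1))"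
      unfolding qs qh C unfolding x_def \<delta>_def e_def m_def .
  qed
qed

section \<open>Accumulation of the errors\<close>

lemma norm_phase_error_le:
  assumes "\<epsilon> > 0"
  shows "norm (y - position_part X) + \<epsilon> * norm (z - (1 / \<epsilon>) *\<^sub>R vector [X $ 3, X $ 4]) \<le> 4 * gnorm (phase \<epsilon> y z - X)"
proof -
  let ?q = "phase \<epsilon> y z - X"
  have "norm (y - position_part X) \<le> \<bar>?q $ 1\<bar> + \<bar>?q $ 2\<bar>"
    using norm_le_l1_cart[of "y - position_part X"] by (simp add: sum_2 position_part_def)
  moreover have "\<epsilon> * norm (z - (1 / \<epsilon>) *\<^sub>R vector [X $ 3, X $ 4]) \<le> \<bar>?q $ 3\<bar> + \<bar>?q $ 4\<bar>"
  proof -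
    have "\<epsilon> * norm (z - (1 / \<epsilon>) *\<^sub>R vector [X $ 3, X $ 4]) = norm (\<epsilon> *\<^sub>R (z - (1 / \<epsilon>) *\<^sub>R vector [X $ 3, X $ 4]))"
      using assms by simp
    also have "\<dots> \<le> (\<Sum>i\<in>UNIV. \<bar>(\<epsilon> *\<^sub>R (z - (1 / \<epsilon>) *\<^sub>R vector [X $ 3, X $ 4])) $ i\<bar>)"
      by (rule norm_le_l1_cart)
    also have "\<dots> = \<bar>?q $ 3\<bar> + \<bar>?q $ 4\<bar>"
      using assms by (simp add: sum_2 right_diff_distrib)
    finally show ?thesis .
  qed
  ultimately show ?thesis
    using nth_le_gnorm[of ?q 1] nth_le_gnorm[of ?q 2] nth_le_gnorm[of ?q 3] nth_le_gnorm[of ?q 4] by linarith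
qed

theorem theorem3p6:
  fixes T :: real and k :: nat and y\<^sub>0 z\<^sub>0 :: "real ^ 2" and E :: "real ^ 2 \<Rightarrow> real ^ 2"
  assumes "T > 0" and "k \<ge> 1" and "lipschitz_derivatives k E"
  shows "\<exists>\<epsilon>\<^sub>0>0. \<exists>C>0. \<forall>\<epsilon> N y z.
           0 < \<epsilon> \<and> \<epsilon> \<le> \<epsilon>\<^sub>0 \<and> N \<ge> 1 \<and> cpd_solution E \<epsilon> T y\<^sub>0 z\<^sub>0 y z \<longrightarrow>
           (let dt = T / real N in
            \<forall>n\<le>N. norm (y (real n * dt) - lle_position k E 0 \<epsilon> dt y\<^sub>0 z\<^sub>0 n)
                   + \<epsilon> * norm (z (real n * dt) - lle_velocity k E 0 \<epsilon> dt y\<^sub>0 z\<^sub>0 n)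
                   \<le> min (C * \<epsilon> ^ (k + 2)) (C * \<epsilon> * dt ^ (k + 1)))"
proof -
  obtain L where L: "L \<ge> 0" 
    "\<And>i b\<^sub>1 b\<^sub>2. b\<^sub>1 + b\<^sub>2 \<le> k \<Longrightarrow> L-lipschitz_on UNIV (partials b\<^sub>1 b\<^sub>2 (\<lambda>y. E y $ i))"
    using lipschitz_derivatives_uniform[OF assms(3)] by blast
  have cC: "of_class_C k (\<lambda>y. E y $ i)" for i
    using assms(3) by (simp add: lipschitz_derivatives_def)
  obtain K where K: "K \<ge> 1"
    "\<And>\<epsilon> y z s t. \<lbrakk>0 < \<epsilon>; \<epsilon> \<le> 1; cpd_solution E \<epsilon> T y\<^sub>0 z\<^sub>0 y z; s \<in> {0..T}; t \<in> {0..T}\<rbrakk>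
      \<Longrightarrow> norm (y t) \<le> K \<and> norm (z t) \<le> K 
        \<and> norm (y t - y s) \<le> K * min \<epsilon> \<bar>t - s\<bar> \<and> \<epsilon> * norm (z t - z s) \<le> K * min \<epsilon> \<bar>t - s\<bar>"
    using cpd_solution_bounds[OF assms(3,1), of y\<^sub>0 z\<^sub>0] by blast
  obtain C where C: "C \<ge> 0" and step:
    "\<And>\<epsilon> y z X s h. \<lbrakk>0 < \<epsilon>; \<epsilon> \<le> 1; 0 \<le> h; h \<le> T;
      \<And>t. t \<in> {s..s+h} \<Longrightarrow> (y has_vector_derivative z t) (at t within {s..s+h});
      \<And>t. t \<in> {s..s+h} \<Longrightarrow> (z has_vector_derivative (1 / \<epsilon>) *\<^sub>R (J *v z t) + E (y t)) (at t within {s..s+h});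
      \<And>t. t \<in> {s..s+h} \<Longrightarrow> norm (y t) \<le> K \<and> norm (z t) \<le> K 
        \<and> norm (y t - y s) \<le> K * min \<epsilon> h \<and> \<epsilon> * norm (z t - z s) \<le> K * min \<epsilon> h;
      gnorm (phase \<epsilon> (y s) (z s) - X) \<le> \<epsilon>\<rbrakk>
      \<Longrightarrow> gnorm (phase \<epsilon> (y (s + h)) (z (s + h)) - (X + proj_x (lle_step k E \<epsilon> h X)))
        \<le> gnorm (phase \<epsilon> (y s) (z s) - X) + C * h * (gnorm (phase \<epsilon> (y s) (z s) - X) + \<epsilon> * min \<epsilon> h ^ (k + 1))"
    using one_step[OF assms(2) cC L(2) K(1), of T] by blast
  \<comment> \<open>\<open>M\<close> bounds the error growth over the whole interval. Taking
    \<open>1 / M\<close> as threshold for \<open>\<epsilon>\<close> keeps the error below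
    \<open>\<epsilon>\<close>, and \<open>4 * M\<close> accounts for the four coordinates in the
    final norms.\<close>
  define M where "M = exp (C * T)"
  have M: "M \<ge> 1" using C assms(1) by (simp add: M_def)
  show ?thesis
  proof (rule exI[of _ "1 / M"], intro conjI exI[of _ "4 * M"] allI impI; (elim conjE)?)
    show "1 / M > 0" "4 * M > 0" using M by auto
    fix \<epsilon> :: real and N :: nat and y z :: "real \<Rightarrow> real ^ 2"
    assume \<epsilon>: "0 < \<epsilon>" "\<epsilon> \<le> 1 / M" and N: "N \<ge> 1" and sol: "cpd_solution E \<epsilon> T y\<^sub>0 z\<^sub>0 y z"
    define h where "h = T / real N"
    define m where "m = min \<epsilon> h"
    define X where "X = lle_state k E 0 \<epsilon> h y\<^sub>0 z\<^sub>0"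
    define e where "e = (\<lambda>n. gnorm (phase \<epsilon> (y (real n * h)) (z (real n * h)) - X n))"
    have \<epsilon>M: "M * \<epsilon> \<le> 1" using \<epsilon>(2) M by (simp add: field_simps)
    have \<epsilon>1: "\<epsilon> \<le> 1" using \<epsilon>(2) M by (smt (verit) divide_le_eq_1)
    have h: "h > 0" "h \<le> T" using N assms(1) by (auto simp: h_def field_simps)
    have m: "0 < m" "m \<le> \<epsilon>" "m \<le> h" using \<epsilon> h by (auto simp: m_def)
    have m1: "m ^ (k + 1) \<le> \<epsilon>"
    proof -
      have "m ^ (k + 1) \<le> m ^ 1" using m \<epsilon>1 by (intro power_decreasing) auto
      then show ?thesis using m by simp
    qed
    \<comment> \<open>With the error shifted by \<open>\<epsilon> * m ^ (k + 1)\<close>, one step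
      multiplies by at most \<open>1 + C * h\<close>, hence by at most
      \<open>exp (C * h)\<close>.\<close>
    have main: "e n + \<epsilon> * m ^ (k + 1) \<le> exp (C * (real n * h)) * (\<epsilon> * m ^ (k + 1))" if "n \<le> N" for n
      using that
    proof (induction n)
      case 0
      have "phase \<epsilon> (y 0) (z 0) - X 0 = 0"
        using sol by (simp add: cpd_solution_def phase_def X_def)
      then have "e 0 = gnorm 0" by (simp add: e_def)
      then show ?case by (simp add: gnorm_def complex_eq_iff)
    next
      case (Suc n)
      let ?s = "real n * h"
      have sh: "?s + h = real (Suc n) * h" by (simp add: algebra_simps)
      have "real (Suc n) * h \<le> real N * h" using Suc.prems h by (intro mult_right_mono) auto
      also have "\<dots> = T" using N by (simp add: h_def)
      finally have sub: "{?s..?s + h} \<subseteq> {0..T}" using h sh by auto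
      have s: "?s \<in> {?s..?s + h}" using h by simp
      have "exp (C * ?s) \<le> M"
        unfolding M_def using C sub s by (auto intro!: mult_left_mono)
      then have "exp (C * ?s) * (\<epsilon> * m ^ (k + 1)) \<le> M * (\<epsilon> * \<epsilon>)"
        using M \<epsilon> m m1 by (intro mult_mono) auto
      also have "\<dots> \<le> \<epsilon>" using mult_right_mono[OF \<epsilon>M, of \<epsilon>] \<epsilon> by (simp add: mult.assoc)
      \<comment> \<open>The induction hypothesis yields the smallness that the next application of
        the step estimate requires.\<close>
      finally have "e n \<le> \<epsilon>" using Suc \<epsilon> m by (smt (verit) Suc_leD mult_pos_pos zero_less_power)
      have "gnorm (phase \<epsilon> (y (?s + h)) (z (?s + h)) - (X n + proj_x (lle_step k E \<epsilon> h (X n))))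
        \<le> e n + C * h * (e n + \<epsilon> * min \<epsilon> h ^ (k + 1))"
        unfolding e_def
      proof (rule step)
        fix t assume t: "t \<in> {?s..?s + h}"
        have dt: "(y has_vector_derivative z t) (at t within {0..T})"
          "(z has_vector_derivative (1 / \<epsilon>) *\<^sub>R (J *v z t) + E (y t)) (at t within {0..T})"
          using sol subsetD[OF sub t] unfolding cpd_solution_def by blast+
        from dt[THEN has_vector_derivative_within_subset, OF sub] 
        show "(y has_vector_derivative z t) (at t within {?s..?s + h})"
          "(z has_vector_derivative (1 / \<epsilon>) *\<^sub>R (J *v z t) + E (y t)) (at t within {?s..?s + h})" .
        have "K * min \<epsilon> \<bar>t - ?s\<bar> \<le> K * min \<epsilon> h"
          using t K(1) by (intro mult_left_mono min.mono) auto
        then show "norm (y t) \<le> K \<and> norm (z t) \<le> K 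
          \<and> norm (y t - y ?s) \<le> K * min \<epsilon> h \<and> \<epsilon> * norm (z t - z ?s) \<le> K * min \<epsilon> h"
          using K(2)[OF \<epsilon>(1) \<epsilon>1 sol, of ?s t] t s sub by (meson order_trans subsetD)
      qed (use \<epsilon> \<epsilon>1 h \<open>e n \<le> \<epsilon>\<close> in \<open>auto simp: e_def\<close>)
      also have "X n + proj_x (lle_step k E \<epsilon> h (X n)) = X (Suc n)"
        unfolding X_def lle_state_Suc[OF \<epsilon>(1)] ..
      finally have "e (Suc n) + \<epsilon> * m ^ (k + 1) \<le> (1 + C * h) * (e n + \<epsilon> * m ^ (k + 1))"
        unfolding sh by (simp add: e_def m_def algebra_simps)
      also have "\<dots> \<le> exp (C * h) * (exp (C * ?s) * (\<epsilon> * m ^ (k + 1)))"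
      proof (intro mult_mono Suc.IH)
        show "0 \<le> e n + \<epsilon> * m ^ (k + 1)" using \<epsilon> m gnorm_nonneg by (simp add: e_def)
      qed (use Suc.prems in auto)
      also have "\<dots> = exp (C * (real (Suc n) * h)) * (\<epsilon> * m ^ (k + 1))"
        by (simp add: algebra_simps flip: exp_add)
      finally show ?case .
    qed
    have "norm (y (real n * h) - lle_position k E 0 \<epsilon> h y\<^sub>0 z\<^sub>0 n)
        + \<epsilon> * norm (z (real n * h) - lle_velocity k E 0 \<epsilon> h y\<^sub>0 z\<^sub>0 n)
        \<le> min (4 * M * \<epsilon> ^ (k + 2)) (4 * M * \<epsilon> * h ^ (k + 1))" if n: "n \<le> N" for n
    proof -
      have nh: "real n * h \<le> T"
        using n N h mult_right_mono[of "real n" "real N" h] by (simp add: h_def)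
      have "norm (y (real n * h) - lle_position k E 0 \<epsilon> h y\<^sub>0 z\<^sub>0 n)
        + \<epsilon> * norm (z (real n * h) - lle_velocity k E 0 \<epsilon> h y\<^sub>0 z\<^sub>0 n) \<le> 4 * e n"
        using norm_phase_error_le[OF \<epsilon>(1)] by (simp add: lle_position_def lle_velocity_def Let_def e_def X_def)
      also have "e n \<le> exp (C * (real n * h)) * (\<epsilon> * m ^ (k + 1))"
        using main[OF n] mult_pos_pos[OF \<epsilon>(1) zero_less_power[OF m(1), of "k + 1"]] by linarith
      also have "\<dots> \<le> M * (\<epsilon> * m ^ (k + 1))"
        unfolding M_def using nh C \<epsilon> m by (intro mult_right_mono) (auto intro: mult_left_mono)
      finally have "norm (y (real n * h) - lle_position k E 0 \<epsilon> h y\<^sub>0 z\<^sub>0 n)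
        + \<epsilon> * norm (z (real n * h) - lle_velocity k E 0 \<epsilon> h y\<^sub>0 z\<^sub>0 n) \<le> 4 * M * \<epsilon> * m ^ (k + 1)" by simp
      \<comment> \<open>Since \<open>m\<close> is the minimum of \<open>\<epsilon>\<close> and
        \<open>h\<close>, both bounds of the theorem follow from the single one.\<close>
      moreover have "4 * M * \<epsilon> * m ^ (k + 1) \<le> 4 * M * \<epsilon> * \<epsilon> ^ (k + 1)" "4 * M * \<epsilon> * m ^ (k + 1) \<le> 4 * M * \<epsilon> * h ^ (k + 1)"
        using m M \<epsilon> by (auto intro!: mult_left_mono power_mono simp del: power_Suc)
      moreover have "4 * M * \<epsilon> * \<epsilon> ^ (k + 1) = 4 * M * \<epsilon> ^ (k + 2)" by (simp add: power_add power2_eq_square)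
      ultimately show ?thesis by linarith
    qed
    then show "let dt = T / real N in
            \<forall>n\<le>N. norm (y (real n * dt) - lle_position k E 0 \<epsilon> dt y\<^sub>0 z\<^sub>0 n)
                   + \<epsilon> * norm (z (real n * dt) - lle_velocity k E 0 \<epsilon> dt y\<^sub>0 z\<^sub>0 n)
                   \<le> min (4 * M * \<epsilon> ^ (k + 2)) (4 * M * \<epsilon> * dt ^ (k + 1))"
      unfolding Let_def h_def by blast
  qed
qed

end
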